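(* Let $A,B$ be $\mathbb{N}_0$-valued random variables such that $0<\mu:=E(A)<1$ and $E(\ln(1+B))<\infty$. Let $\alpha\in(0,2)$ and let $L$ be a slowly varying function such that $P(B>x)=x^{-\alpha}L(x)$. If $\alpha\in[1,2)$, assume moreover that $E(A^2)<\infty$. Assume finally that one of the following two conditions holds: (i) $E(B)<\infty$ and $P(A>x)=o(P(B>x))$ as $x\to\infty$; or (ii) $E(B)=\infty$ and $xP(A>x)=o(P(B>x))$ as $x\to\infty$. Let $X_t$ and $X'_t$ be random variables with $X_t\stackrel{d}{=}\sum_{k=0}^\infty C_{t,k}$ and $X'_t\stackrel{d}{=}\sup_{k\ge 0}C_{t,k}$. Then $$\lim_{x\to\infty}\frac{P(X_t>x)}{P(B>x)}=\lim_{x\to\infty}\frac{P(X'_t>x)}{P(B>x)}=\sum_{k=0}^\infty\mu^{k\alpha}.$$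
   Context: $\mathbb{N}_0=\{0,1,2,\dots\}$. A random mapping $\theta$ with offspring variable $A$ is defined by $\theta\circ x=\theta(x)=\sum_{i=1}^x A_i$ for $x\in\mathbb{N}_0$, where $(A_i)$ are i.i.d. copies of $A$. Let $(B_t)_{t\in\mathbb{Z}}$ be i.i.d. copies of $B$, and let $(\theta^{(s)}_t)_{s,t\in\mathbb{Z}}$ be independent random mappings with offspring variable $A$, independent of $(B_t)$. Put $C_{t,0}=B_t$ and, for $k\ge1$, $C_{t,k}=\theta^{(t-k)}_t\circ\theta^{(t-k)}_{t-1}\circ\cdots\circ\theta^{(t-k)}_{t-k+1}(B_{t-k})$. For fixed $t$ the variables $(C_{t,k})_{k\ge0}$ are independent, and $C_{t,k}$ is distributed as the sum of $B_{t-k}$ independent copies (independent of $B_{t-k}$) of the size of the $k$-th generation of a Galton–Watson process with offspring law that of $A$ started from one individual. The law of $\sum_{k\ge 0} C_{t,k}$ is the unique stationary distribution of the branching process with immigration $X_t=\sum_{i=1}^{X_{t-1}}A^{(t)}_i+B_t$, where $(A_i^{(t)})_{i,t}$ are i.i.d. copies of $A$ independent of $(B_t)$. *)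

theory Defs
  imports "HOL-Probability.Probability" "HOL-Library.Landau_Symbols"
begin

definition slowly_varying :: "(real \<Rightarrow> real) \<Rightarrow> bool" where
  "slowly_varying L \<longleftrightarrow>
     (\<exists>a>0. L \<in> borel_measurable (restrict_space borel {a..}) \<and> (\<forall>x\<ge>a. L x > 0)) \<and>
     (\<forall>c>0. ((\<lambda>x. L (c * x) / L x) \<longlongrightarrow> 1) at_top)"

text \<open>The copies \<open>A\<^sub>1, A\<^sub>2, \<dots>\<close> driving a random mapping are indexed from \<open>0\<close> here.\<close>

definition random_map :: "(nat \<Rightarrow> 'm \<Rightarrow> nat) \<Rightarrow> 'm \<Rightarrow> nat \<Rightarrow> nat" where
  "random_map a \<omega> x = (\<Sum>i<x. a i \<omega>)"

text \<open>\<open>compose_maps \<theta> s k\<close> is the composition \<open>\<theta> (s + k) \<circ> \<dots> \<circ> \<theta> (s + 1)\<close>.\<close>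

primrec compose_maps :: "(int \<Rightarrow> nat \<Rightarrow> nat) \<Rightarrow> int \<Rightarrow> nat \<Rightarrow> nat \<Rightarrow> nat" where
  "compose_maps \<theta> s 0 = id"
| "compose_maps \<theta> s (Suc k) = \<theta> (s + int (Suc k)) \<circ> compose_maps \<theta> s k"

text \<open>In \<open>C a b t k\<close>, the sequence \<open>a s u\<close> drives the random mapping with superscript \<open>s\<close>
  and subscript \<open>u\<close>, and \<open>b\<close> is the immigration sequence.\<close>

definition C :: "(int \<Rightarrow> int \<Rightarrow> nat \<Rightarrow> 'm \<Rightarrow> nat) \<Rightarrow> (int \<Rightarrow> 'm \<Rightarrow> nat) \<Rightarrow> int \<Rightarrow> nat \<Rightarrow> 'm \<Rightarrow> nat"
  where
  "C a b t k \<omega> =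
     compose_maps (\<lambda>u. random_map (a (t - int k) u) \<omega>) (t - int k) k (b (t - int k) \<omega>)"

end

theory Submission
  imports Defs
begin

text \<open>
  Throughout, \<open>F x = P(B > x)\<close>, and \<open>gw_pmf p k n\<close> is the law of the \<open>k\<close>-th generation of a
  Galton--Watson process with offspring law \<open>p\<close> (the law of \<open>A\<close>) started from \<open>n\<close> individuals.
  The theorem is an instance of the principle of one big jump.

  A single generation. Started from a large \<open>n\<close>, the \<open>k\<close>-th generation is close to \<open>\<mu>\<^sup>k n\<close>
  (\<open>gw_concentration\<close>, a weak law in \<open>L\<^sup>1\<close>). Hence \<open>C\<^sub>k\<close>, which starts from \<open>B\<close>, exceeds a large
  \<open>x\<close> essentially only if \<open>B > x / \<mu>\<^sup>k\<close>, and by regular variation this has probability about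
  \<open>\<mu>\<^bsup>k\<alpha>\<^esup> F x\<close> (\<open>C_exceed_asymp\<close>). It remains to exclude that a \<open>B\<close> much smaller than \<open>x\<close>
  produces a \<open>C\<^sub>k\<close> above \<open>x\<close>. By Markov's inequality (for \<open>\<alpha> < 1\<close>) or Chebyshev's inequality (for
  \<open>\<alpha> \<ge> 1\<close>, where \<open>A\<close> has a second moment) the probability of this is bounded by the truncated mean
  \<open>E[B; B \<le> z]\<close> times \<open>x\<^sup>-\<^sup>1\<close> or \<open>x\<^sup>-\<^sup>2\<close>, and the truncated mean is at most of order \<open>z F z\<close>
  or \<open>z powr (1 - \<alpha>/2)\<close>, respectively.

  All generations. The same inequalities, with thresholds that decrease geometrically but more slowly
  than \<open>\<mu>\<^sup>k\<close>, give a bound for the \<open>k\<close>-th generation that is \<open>F x\<close> times a geometric sequence in \<open>k\<close>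
  (\<open>C_exceed_geometric\<close>). So the generations from \<open>K\<close> on contribute to \<open>P(\<Sum>C\<^sub>k > x) / F x\<close> an
  amount that is small uniformly in large \<open>x\<close>.

  Finitely many generations. The variables \<open>C\<^sub>0, C\<^sub>1, \<dots>\<close> are pairwise independent because \<open>C\<^sub>k\<close> is a
  function of \<open>B\<^sub>t\<^sub>-\<^sub>k\<close> and of the random mappings with superscript \<open>t - k\<close> only. So two of them are simultaneously of
  order \<open>x\<close> with probability \<open>O(F x\<^sup>2)\<close>, which is negligible. Up to this event, the sum exceeds \<open>x\<close>
  only if a single term exceeds \<open>(1 - 2e) x\<close>; this bounds the tail of the sum from above
  (\<open>progeny_upper\<close>). The maximum is bounded from below by Bonferroni's inequality
  (\<open>largest_lower\<close>), and it lies below the sum, so both have the same limit.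
\<close>

section \<open>Regularly varying tails and truncated means\<close>

text \<open>A bound that survives doubling of the argument holds on all of \<open>[x\<^sub>0, \<infinity>)\<close> once it holds on
  \<open>[x\<^sub>0, 2 x\<^sub>0]\<close>. The estimates for regularly varying functions below rest on this principle and on the
  single ratio \<open>F (2 x) / F x\<close>.\<close>

lemma doubling_induct [consumes 2, case_names base step]:
  fixes x0 x :: real
  assumes "0 < x0" "x0 \<le> x"
    and base: "\<And>x. x0 \<le> x \<Longrightarrow> x \<le> 2 * x0 \<Longrightarrow> Q x"
    and step: "\<And>x. x0 \<le> x \<Longrightarrow> Q x \<Longrightarrow> Q (2 * x)"
  shows "Q x"
proof -
  have *: "Q x" if "x0 \<le> x" "x \<le> 2 ^ Suc n * x0" for x n
    using that
  proof (induction n arbitrary: x)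
    case 0
    then show ?case using base by simp
  next
    case (Suc n)
    show ?case
    proof (cases "x \<le> 2 * x0")
      case True
      then show ?thesis using base Suc.prems by blast
    next
      case False
      then have "Q (x / 2)" using Suc by auto
      then show ?thesis using step[of "x/2"] False by auto
    qed
  qed
  obtain n where "x / x0 < 2 ^ n" using real_arch_pow[of 2 "x/x0"] by auto
  then have "x \<le> 2 ^ Suc n * x0" using assms(1,2) by (simp add: field_simps)
  then show ?thesis using * assms(2) by blast
qed

locale rv_tail =
  fixes F :: "real \<Rightarrow> real" and \<alpha> :: real
  assumes pos: "\<And>x. F x > 0"
    and anti: "\<And>x y. x \<le> y \<Longrightarrow> F y \<le> F x"
    and ratio: "\<And>c. c > 0 \<Longrightarrow> ((\<lambda>x. F (c * x) / F x) \<longlongrightarrow> c powr (-\<alpha>)) at_top"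
    and alpha_pos: "\<alpha> > 0"
begin

lemma eventually_scaled_le:
  assumes "c > 0" "c powr (-\<alpha>) < d"
  shows "\<forall>\<^sub>F x in at_top. F (c * x) \<le> d * F x"
  using order_tendstoD(2)[OF ratio[OF assms(1)] assms(2)]
  by eventually_elim (use pos in \<open>simp add: field_simps less_imp_le\<close>)

lemma eventually_scaled_ge:
  assumes "c > 0" "d < c powr (-\<alpha>)"
  shows "\<forall>\<^sub>F x in at_top. d * F x \<le> F (c * x)"
  using order_tendstoD(1)[OF ratio[OF assms(1)] assms(2)]
  by eventually_elim (use pos in \<open>simp add: field_simps less_imp_le\<close>)

text \<open>The upper half of Potter's bounds. Eventually \<open>F (2 x) \<le> 2 powr (-\<beta>) * F x\<close>, as
  \<open>2 powr (-\<alpha>) < 2 powr (-\<beta>)\<close>; doubling takes care of all arguments \<open>l x\<close>, and monotonicity of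
  the gaps between powers of two, at the cost of the factor \<open>2 powr \<beta>\<close>.\<close>

lemma potter_upper:
  assumes "0 \<le> \<beta>" "\<beta> < \<alpha>"
  obtains D x0 where "D > 0" "x0 > 0"
    "\<And>x l. x \<ge> x0 \<Longrightarrow> l \<ge> 1 \<Longrightarrow> F (l * x) \<le> D * l powr (-\<beta>) * F x"
proof -
  have "\<forall>\<^sub>F x in at_top. F (2 * x) \<le> 2 powr (-\<beta>) * F x"
    using assms by (intro eventually_scaled_le) auto
  then obtain x1 where x1: "\<And>x. x \<ge> x1 \<Longrightarrow> F (2 * x) \<le> 2 powr (-\<beta>) * F x"
    unfolding eventually_at_top_linorder by blast
  define x0 where "x0 = max x1 1"
  show thesis
  proof (rule that[of "2 powr \<beta>" x0])
    fix x l :: real assume x: "x \<ge> x0" and l: "l \<ge> 1"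
    have xp: "x > 0" using x by (simp add: x0_def)
    have "x \<le> l * x" using l xp by simp
    then show "F (l * x) \<le> 2 powr \<beta> * l powr (-\<beta>) * F x"
    proof -
      have "F y \<le> 2 powr \<beta> * (y / x) powr (-\<beta>) * F x" if "x \<le> y" for y
        using xp that
      proof (induction rule: doubling_induct)
        case (base y)
        have "2 powr (-\<beta>) \<le> (y / x) powr (-\<beta>)"
          using base xp assms by (intro powr_mono2') (auto simp: field_simps)
        then have "1 \<le> 2 powr \<beta> * (y / x) powr (-\<beta>)"
          by (simp add: powr_minus field_simps)
        then have "1 * F x \<le> 2 powr \<beta> * (y / x) powr (-\<beta>) * F x"
          using less_imp_le[OF pos] by (rule mult_right_mono)
        then show ?case using anti[OF base(1)] by simp
      next
        case (step y)
        have "F (2 * y) \<le> 2 powr (-\<beta>) * F y" using step x by (intro x1) (simp add: x0_def)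
        also have "\<dots> \<le> 2 powr (-\<beta>) * (2 powr \<beta> * (y / x) powr (-\<beta>) * F x)"
          using step by simp
        also have "\<dots> = 2 powr \<beta> * (2 powr (-\<beta>) * (y / x) powr (-\<beta>)) * F x" by simp
        also have "2 powr (-\<beta>) * (y / x) powr (-\<beta>) = (2 * y / x) powr (-\<beta>)"
          using xp step by (simp add: powr_mult[symmetric])
        finally show ?case .
      qed
      from this[OF \<open>x \<le> l * x\<close>] show ?thesis using xp by simp
    qed
  qed (auto simp: x0_def)
qed

text \<open>With an exponent \<open>g\<close> strictly between \<open>\<alpha>\<close> and \<open>\<gamma>\<close>, doubling gives \<open>F x \<ge> c * x powr (-g)\<close>,
  and \<open>x powr (-\<gamma>)\<close> is of smaller order than \<open>x powr (-g)\<close>.\<close>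

lemma powr_smallo:
  assumes "\<gamma> > \<alpha>" "e > 0"
  shows "\<forall>\<^sub>F x in at_top. x powr (-\<gamma>) \<le> e * F x"
proof -
  define g where "g = (\<alpha> + \<gamma>) / 2"
  have g: "\<alpha> < g" "g < \<gamma>" using assms by (auto simp: g_def)
  have "\<forall>\<^sub>F x in at_top. 2 powr (-g) * F x \<le> F (2 * x)"
    using g by (intro eventually_scaled_ge) auto
  then obtain x1 where x1: "\<And>x. x \<ge> x1 \<Longrightarrow> 2 powr (-g) * F x \<le> F (2 * x)"
    unfolding eventually_at_top_linorder by blast
  define x0 where "x0 = max x1 1"
  have x0: "x0 > 0" by (simp add: x0_def)
  define c where "c = F (2 * x0) / x0 powr (-g)"
  have c: "c > 0" using pos x0 by (simp add: c_def)
  have lower: "c * x powr (-g) \<le> F x" if "x0 \<le> x" for x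
    using x0 that
  proof (induction rule: doubling_induct)
    case (base x)
    have "x powr (-g) \<le> x0 powr (-g)" using base x0 g alpha_pos by (intro powr_mono2') auto
    then have "c * x powr (-g) \<le> F (2 * x0)"
      unfolding c_def using x0 pos[of "2*x0"] by (simp add: divide_le_eq mult.commute)
    then show ?case using anti[OF base(2)] by simp
  next
    case (step x)
    have "c * (2 * x) powr (-g) = 2 powr (-g) * (c * x powr (-g))"
      using step x0 by (simp add: powr_mult)
    also have "\<dots> \<le> 2 powr (-g) * F x" using step by simp
    also have "\<dots> \<le> F (2 * x)" using step by (intro x1) (simp add: x0_def)
    finally show ?case .
  qed
  have "((\<lambda>x::real. x powr (-(\<gamma> - g))) \<longlongrightarrow> 0) at_top"
    using g by (intro tendsto_neg_powr filterlim_ident) auto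
  then have "\<forall>\<^sub>F x in at_top. x powr (-(\<gamma> - g)) < e * c"
    using order_tendstoD(2) assms c by (metis mult_pos_pos)
  then show ?thesis using eventually_ge_at_top[of x0]
  proof eventually_elim
    case (elim x)
    have "x powr (-\<gamma>) = x powr (-(\<gamma> - g)) * x powr (-g)"
      by (simp add: powr_add[symmetric])
    also have "\<dots> \<le> e * c * x powr (-g)" using elim by (intro mult_right_mono) auto
    also have "\<dots> \<le> e * F x" using lower[of x] elim assms by (simp add: mult.assoc)
    finally show ?case .
  qed
qed

lemma tendsto_0: "(F \<longlongrightarrow> 0) at_top"
proof -
  have "\<forall>\<^sub>F x in at_top. F x < e" if "e > 0" for e
  proof -
    obtain D x0 where D: "D > 0" "x0 > 0"
      "\<And>x l. x \<ge> x0 \<Longrightarrow> l \<ge> 1 \<Longrightarrow> F (l * x) \<le> D * l powr (-(\<alpha>/2)) * F x"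
      using potter_upper[of "\<alpha>/2"] alpha_pos by auto
    have "((\<lambda>x::real. D * x powr (-(\<alpha>/2)) * F x0) \<longlongrightarrow> D * 0 * F x0) at_top"
      using alpha_pos by (intro tendsto_intros tendsto_neg_powr filterlim_ident) auto
    then have "\<forall>\<^sub>F l in at_top. D * l powr (-(\<alpha>/2)) * F x0 < e"
      using order_tendstoD(2) that by fastforce
    then have "\<forall>\<^sub>F l in at_top. F (l * x0) < e"
      using eventually_ge_at_top[of 1]
      by eventually_elim (use D(2) D(3)[OF order_refl] in \<open>blast intro: le_less_trans\<close>)
    then obtain l where l: "F (l * x0) < e" 
      by (metis eventually_at_top_linorder order_refl)
    then show ?thesis
      unfolding eventually_at_top_linorder using anti le_less_trans by blast
  qed
  then show ?thesis
    using pos by (intro order_tendstoI) (auto intro: always_eventually less_trans)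
qed

text \<open>The function \<open>f\<close> stands for the truncated mean \<open>E[B; B \<le> z]\<close>, which grows by at most \<open>2 z F z\<close>
  when \<open>z\<close> doubles. If the comparison function \<open>h\<close> dominates this increment and itself grows by a factor
  \<open>q > 1\<close>, then the increments form a geometric sum, which is dominated by its last term. This replaces
  Karamata's theorem.\<close>

lemma doubling_sum_bound:
  fixes f h :: "real \<Rightarrow> real"
  assumes f: "\<And>z. z > 0 \<Longrightarrow> f z \<le> z"
    and f2: "\<And>z. z > 0 \<Longrightarrow> f (2 * z) \<le> f z + 2 * z * F z"
    and x1: "x1 > 0" and m: "m > 0" and D: "D \<ge> 0" and q: "q > 1"
    and h_low: "\<And>z. x1 \<le> z \<Longrightarrow> z \<le> 2 * x1 \<Longrightarrow> m \<le> h z"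
    and hF: "\<And>z. z \<ge> x1 \<Longrightarrow> z * F z \<le> D * h z"
    and h2: "\<And>z. z \<ge> x1 \<Longrightarrow> q * h z \<le> h (2 * z)"
  obtains c where "c > 0" "\<And>z. z \<ge> x1 \<Longrightarrow> f z \<le> c * h z"
proof -
  \<comment> \<open>The first entry starts the induction on \<open>[x\<^sub>1, 2 x\<^sub>1]\<close>; the second makes \<open>c + 2 D \<le> c q\<close>, which closes the doubling step.\<close>
  define c where "c = max (2 * x1 / m) (2 * D / (q - 1))"
  have c: "c > 0" "c * m \<ge> 2 * x1" "c * (q - 1) \<ge> 2 * D"
    using m x1 q by (simp_all add: c_def less_max_iff_disj max_mult_distrib_right)
  have "f z \<le> c * h z" if "x1 \<le> z" for z
    using x1 that
  proof (induction rule: doubling_induct)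
    case (base z)
    have "f z \<le> 2 * x1" using f[of z] base x1 by linarith
    also have "\<dots> \<le> c * m" by fact
    also have "\<dots> \<le> c * h z" using h_low[OF base] c by simp
    finally show ?case .
  next
    case (step z)
    have hp: "0 \<le> h z"
    proof -
      have "0 < h z" using x1 step(1)
      proof (induction rule: doubling_induct)
        case (base x) then show ?case using h_low[of x] m by simp
      next
        case (step x) 
        have "0 < q * h x" using step q by simp
        then show ?case using h2[of x] step by simp
      qed
      then show ?thesis by simp
    qed
    have "f (2 * z) \<le> f z + 2 * (z * F z)" using f2[of z] step x1 by simp
    also have "\<dots> \<le> c * h z + 2 * (D * h z)" using step hF[of z] by simp
    also have "\<dots> = (c + 2 * D) * h z" by (simp add: algebra_simps)
    also have "\<dots> \<le> (c * q) * h z" using c hp by (intro mult_right_mono) (auto simp: algebra_simps)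
    also have "\<dots> \<le> c * h (2 * z)" using h2[of z] step c by (simp add: mult.assoc)
    finally show ?case .
  qed
  then show thesis using that c by blast
qed

text \<open>For \<open>\<alpha> < 1\<close> the function \<open>z F z\<close> grows like a positive power of \<open>z\<close>, so it can be its own
  comparison function.\<close>

lemma truncated_mean_le_tail:
  fixes f :: "real \<Rightarrow> real"
  assumes f: "\<And>z. z > 0 \<Longrightarrow> f z \<le> z"
    and f2: "\<And>z. z > 0 \<Longrightarrow> f (2 * z) \<le> f z + 2 * z * F z"
    and "\<alpha> < 1"
  obtains c x0 where "c > 0" "x0 > 0" "\<And>z. z \<ge> x0 \<Longrightarrow> f z \<le> c * (z * F z)"
proof -
  define g where "g = (\<alpha> + 1) / 2"
  have g: "\<alpha> < g" "g < 1" using assms by (auto simp: g_def)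
  have "\<forall>\<^sub>F x in at_top. 2 powr (-g) * F x \<le> F (2 * x)"
    using g by (intro eventually_scaled_ge) auto
  then obtain x1 where x1: "\<And>x. x \<ge> x1 \<Longrightarrow> 2 powr (-g) * F x \<le> F (2 * x)"
    unfolding eventually_at_top_linorder by blast
  define x0 where "x0 = max x1 1"
  have x0: "x0 > 0" by (simp add: x0_def)
  obtain c where "c > 0" "\<And>z. z \<ge> x0 \<Longrightarrow> f z \<le> c * (z * F z)"
  proof (rule doubling_sum_bound[OF f f2 x0, of "x0 * F (2 * x0)" 1 "2 powr (1 - g)" "\<lambda>z. z * F z"])
    show "0 < x0 * F (2 * x0)" using x0 pos by simp
    show "1 < 2 powr (1 - g)" using g by simp
    show "x0 * F (2 * x0) \<le> z * F z" if "x0 \<le> z" "z \<le> 2 * x0" for z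
      using that x0 anti[OF that(2)] pos[of "2*x0"] by (intro mult_mono) auto
    show "2 powr (1 - g) * (z * F z) \<le> 2 * z * F (2 * z)" if "x0 \<le> z" for z
    proof -
      have "2 powr (1 - g) * (z * F z) = 2 * z * (2 powr (-g) * F z)"
        by (simp add: powr_diff powr_minus divide_inverse)
      also have "\<dots> \<le> 2 * z * F (2 * z)"
        using that x0 by (intro mult_left_mono x1) (auto simp: x0_def)
      finally show ?thesis .
    qed
  qed (use that in auto)
  then show thesis using that x0 by blast
qed

text \<open>For \<open>\<alpha> \<ge> 1\<close> the function \<open>z F z\<close> need not grow, so a cruder comparison is used:
  \<open>F z = O(z powr (-\<alpha>/2))\<close>. The exponent \<open>1 - \<alpha>/2\<close> is positive, as the geometric sum requires, and
  it satisfies \<open>(1 - \<alpha>/2) - 2 < -\<alpha>\<close>, so that dividing by \<open>z\<^sup>2\<close> yields something negligible with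
  respect to \<open>F z\<close>.\<close>

lemma truncated_mean_le_powr:
  fixes f :: "real \<Rightarrow> real"
  assumes f: "\<And>z. z > 0 \<Longrightarrow> f z \<le> z"
    and f2: "\<And>z. z > 0 \<Longrightarrow> f (2 * z) \<le> f z + 2 * z * F z"
    and "\<alpha> < 2"
  obtains c x0 where "c > 0" "x0 > 0" "\<And>z. z \<ge> x0 \<Longrightarrow> f z \<le> c * z powr (1 - \<alpha> / 2)"
proof -
  obtain D x0 where D: "D > 0" "x0 > 0"
    "\<And>x l. x \<ge> x0 \<Longrightarrow> l \<ge> 1 \<Longrightarrow> F (l * x) \<le> D * l powr (-(\<alpha>/2)) * F x"
    using potter_upper[of "\<alpha>/2"] alpha_pos by auto
  have FF: "F z \<le> D * F x0 * x0 powr (\<alpha>/2) * z powr (-(\<alpha>/2))" if "z \<ge> x0" for z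
  proof -
    have "F (z / x0 * x0) \<le> D * (z / x0) powr (-(\<alpha>/2)) * F x0"
      using that D(2) by (intro D(3)) (auto simp: field_simps)
    also have "(z / x0) powr (-(\<alpha>/2)) = z powr (-(\<alpha>/2)) * x0 powr (\<alpha>/2)"
    proof -
      have "(z / x0) powr (-b) = z powr (-b) * x0 powr b" for b
        using D(2) that by (simp add: powr_divide powr_minus field_simps)
      then show ?thesis .
    qed
    finally show ?thesis using D(1,2) by (simp add: mult_ac)
  qed
  obtain c where "c > 0" "\<And>z. z \<ge> x0 \<Longrightarrow> f z \<le> c * z powr (1 - \<alpha>/2)"
  proof (rule doubling_sum_bound[OF f f2 D(2), of "x0 powr (1 - \<alpha>/2)" "D * F x0 * x0 powr (\<alpha>/2)"
       "2 powr (1 - \<alpha>/2)" "\<lambda>z. z powr (1 - \<alpha>/2)"])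
    show "0 \<le> D * F x0 * x0 powr (\<alpha>/2)" using D(1) pos[of x0] by simp
    show "1 < 2 powr (1 - \<alpha>/2)" using assms by simp
    show "z * F z \<le> D * F x0 * x0 powr (\<alpha>/2) * z powr (1 - \<alpha>/2)" if "x0 \<le> z" for z
    proof -
      have z: "z > 0" using that D(2) by simp
      have "z * F z \<le> z * (D * F x0 * x0 powr (\<alpha>/2) * z powr (-(\<alpha>/2)))"
        using z FF[OF that] by simp
      also have "\<dots> = D * F x0 * x0 powr (\<alpha>/2) * z powr (1 - \<alpha>/2)"
        using powr_mult_base[of z "-(\<alpha>/2)"] z by simp
      finally show ?thesis .
    qed
    show "2 powr (1 - \<alpha>/2) * z powr (1 - \<alpha>/2) \<le> (2 * z) powr (1 - \<alpha>/2)" if "x0 \<le> z" for z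
      using that D(2) by (simp add: powr_mult)
    show "x0 powr (1 - \<alpha>/2) \<le> z powr (1 - \<alpha>/2)" if "x0 \<le> z" for z
      using that D(2) assms by (intro powr_mono2) auto
  qed (use D(1,2) that in auto)
  then show thesis using that D(2) by blast
qed

end

section \<open>Moments and the weak law for Galton--Watson generations\<close>

primrec iid_sum_pmf :: "nat pmf \<Rightarrow> nat \<Rightarrow> nat pmf" where
  "iid_sum_pmf p 0 = return_pmf 0"
| "iid_sum_pmf p (Suc n) = bind_pmf p (\<lambda>a. map_pmf ((+) a) (iid_sum_pmf p n))"

primrec gw_pmf :: "nat pmf \<Rightarrow> nat \<Rightarrow> nat \<Rightarrow> nat pmf" where
  "gw_pmf p 0 n = return_pmf n"
| "gw_pmf p (Suc k) n = bind_pmf (gw_pmf p k n) (iid_sum_pmf p)"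

lemma nn_integral_pmf_const [simp]: "(\<integral>\<^sup>+x. c \<partial>measure_pmf p) = c"
  using measure_pmf.emeasure_space_1[of p] by simp

lemma mean_iid_sum:
  fixes p :: "nat pmf"
  assumes "(\<integral>\<^sup>+a. ennreal (real a) \<partial>p) = ennreal \<mu>" "0 \<le> \<mu>"
  shows "(\<integral>\<^sup>+y. ennreal (real y) \<partial>iid_sum_pmf p n) = ennreal (real n * \<mu>)"
proof (induction n)
  case (Suc n)
  have "(\<integral>\<^sup>+y. ennreal (real y) \<partial>iid_sum_pmf p (Suc n)) =
     (\<integral>\<^sup>+a. (\<integral>\<^sup>+y. ennreal (real a) + ennreal (real y) \<partial>iid_sum_pmf p n) \<partial>p)"
    by (simp flip: ennreal_plus)
  also have "\<dots> = ennreal \<mu> + ennreal (real n * \<mu>)"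
    by (simp add: nn_integral_add Suc assms)
  also have "\<dots> = ennreal (real (Suc n) * \<mu>)"
    using assms by (simp add: algebra_simps flip: ennreal_plus)
  finally show ?case .
qed simp

lemma second_moment_iid_sum:
  fixes p :: "nat pmf"
  assumes mean: "(\<integral>\<^sup>+a. ennreal (real a) \<partial>p) = ennreal \<mu>" "0 \<le> \<mu>"
    and sq: "(\<integral>\<^sup>+a. ennreal ((real a)\<^sup>2) \<partial>p) = ennreal (v + \<mu>\<^sup>2)" "0 \<le> v"
  shows "(\<integral>\<^sup>+y. ennreal ((real y)\<^sup>2) \<partial>iid_sum_pmf p n) = ennreal (real n * v + (real n * \<mu>)\<^sup>2)"
proof (induction n)
  case (Suc n)
  have *: "ennreal ((real (a + y))\<^sup>2) =
      ennreal ((real a)\<^sup>2) + (ennreal (2 * real a) * ennreal (real y) + ennreal ((real y)\<^sup>2))" for a y :: nat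
    by (simp add: power2_eq_square algebra_simps flip: ennreal_plus ennreal_mult)
  have "(\<integral>\<^sup>+y. ennreal ((real y)\<^sup>2) \<partial>iid_sum_pmf p (Suc n)) =
     (\<integral>\<^sup>+a. (\<integral>\<^sup>+y. ennreal ((real (a + y))\<^sup>2) \<partial>iid_sum_pmf p n) \<partial>p)"
    by simp
  also have "\<dots> = (\<integral>\<^sup>+a. ennreal ((real a)\<^sup>2) + (ennreal (2 * real a) * ennreal (real n * \<mu>)
      + ennreal (real n * v + (real n * \<mu>)\<^sup>2)) \<partial>p)"
    unfolding * by (simp add: nn_integral_add nn_integral_cmult Suc mean_iid_sum[OF mean])
  also have "\<dots> = (\<integral>\<^sup>+a. ennreal ((real a)\<^sup>2) + (ennreal (2 * real n * \<mu>) * ennreal (real a)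
      + ennreal (real n * v + (real n * \<mu>)\<^sup>2)) \<partial>p)"
    using assms by (simp add: mult_ac flip: ennreal_mult)
  also have "\<dots> = ennreal (v + \<mu>\<^sup>2) + (ennreal (2 * real n * \<mu>) * ennreal \<mu>
      + ennreal (real n * v + (real n * \<mu>)\<^sup>2))"
    by (simp add: nn_integral_add nn_integral_cmult mean sq)
  also have "\<dots> = ennreal ((v + \<mu>\<^sup>2) + (2 * real n * \<mu> * \<mu> + (real n * v + (real n * \<mu>)\<^sup>2)))"
    using assms by (simp flip: ennreal_plus ennreal_mult)
  also have "(v + \<mu>\<^sup>2) + (2 * real n * \<mu> * \<mu> + (real n * v + (real n * \<mu>)\<^sup>2))
     = real (Suc n) * v + (real (Suc n) * \<mu>)\<^sup>2"
    by (simp add: power2_eq_square algebra_simps)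
  finally show ?case .
qed simp

lemma mean_gw:
  fixes p :: "nat pmf"
  assumes "(\<integral>\<^sup>+a. ennreal (real a) \<partial>p) = ennreal \<mu>" "0 \<le> \<mu>"
  shows "(\<integral>\<^sup>+y. ennreal (real y) \<partial>gw_pmf p k n) = ennreal (\<mu> ^ k * real n)"
proof (induction k)
  case (Suc k)
  have "(\<integral>\<^sup>+y. ennreal (real y) \<partial>gw_pmf p (Suc k) n) =
     (\<integral>\<^sup>+m. ennreal \<mu> * ennreal (real m) \<partial>gw_pmf p k n)"
    using assms by (simp add: mean_iid_sum[OF assms] mult.commute flip: ennreal_mult)
  also have "\<dots> = ennreal (\<mu> ^ Suc k * real n)"
    using assms by (subst nn_integral_cmult, simp, subst Suc, simp add: mult_ac flip: ennreal_mult)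
  finally show ?case .
qed simp

text \<open>Given the \<open>k\<close>-th generation \<open>m\<close>, the next one has second moment \<open>m v + (\<mu> m)\<^sup>2\<close>, where \<open>v\<close> is the
  variance of the offspring law. The constant \<open>c = v / (\<mu> - \<mu>\<^sup>2)\<close> is the fixed point of the resulting
  recursion \<open>v + \<mu>\<^sup>2 c = c \<mu>\<close>: the variance of the \<open>k\<close>-th generation is at most \<open>c \<mu>\<^sup>k n\<close>.\<close>

lemma second_moment_gw:
  fixes p :: "nat pmf"
  assumes mean: "(\<integral>\<^sup>+a. ennreal (real a) \<partial>p) = ennreal \<mu>" "0 < \<mu>" "\<mu> < 1"
    and sq: "(\<integral>\<^sup>+a. ennreal ((real a)\<^sup>2) \<partial>p) = ennreal (v + \<mu>\<^sup>2)" "0 \<le> v"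
  shows "(\<integral>\<^sup>+y. ennreal ((real y)\<^sup>2) \<partial>gw_pmf p k n)
     \<le> ennreal (v / (\<mu> - \<mu>\<^sup>2) * \<mu> ^ k * real n + (\<mu> ^ k * real n)\<^sup>2)"
proof (induction k)
  case 0
  have "\<mu> - \<mu>\<^sup>2 \<ge> 0" using mean by (simp add: power2_eq_square mult_le_cancel_right1)
  then show ?case using sq by (auto intro!: ennreal_leI)
next
  case (Suc k)
  define c where "c = v / (\<mu> - \<mu>\<^sup>2)"
  have mm: "\<mu> - \<mu>\<^sup>2 > 0" using mean by (simp add: power2_eq_square)
  have c: "c \<ge> 0" "v + \<mu>\<^sup>2 * c = c * \<mu>" using mm sq by (auto simp: c_def field_simps)
  have "(\<integral>\<^sup>+y. ennreal ((real y)\<^sup>2) \<partial>gw_pmf p (Suc k) n)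
     = (\<integral>\<^sup>+m. ennreal (real m * v + (real m * \<mu>)\<^sup>2) \<partial>gw_pmf p k n)"
    using mean by (simp add: second_moment_iid_sum[OF mean(1) _ sq])
  also have "\<dots> = (\<integral>\<^sup>+m. ennreal v * ennreal (real m) + ennreal (\<mu>\<^sup>2) * ennreal ((real m)\<^sup>2) \<partial>gw_pmf p k n)"
    using sq mean by (simp add: power_mult_distrib mult.commute flip: ennreal_plus ennreal_mult)
  also have "\<dots> = ennreal v * ennreal (\<mu> ^ k * real n)
      + ennreal (\<mu>\<^sup>2) * (\<integral>\<^sup>+m. ennreal ((real m)\<^sup>2) \<partial>gw_pmf p k n)"
    using mean by (simp add: nn_integral_add nn_integral_cmult mean_gw[OF mean(1)])
  also have "\<dots> \<le> ennreal v * ennreal (\<mu> ^ k * real n)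
      + ennreal (\<mu>\<^sup>2) * ennreal (c * \<mu> ^ k * real n + (\<mu> ^ k * real n)\<^sup>2)"
    using Suc unfolding c_def by (intro add_left_mono mult_left_mono) auto
  also have "\<dots> = ennreal (v * (\<mu> ^ k * real n) + \<mu>\<^sup>2 * (c * \<mu> ^ k * real n + (\<mu> ^ k * real n)\<^sup>2))"
    using sq mean c by (simp flip: ennreal_plus ennreal_mult)
  also have "v * (\<mu> ^ k * real n) + \<mu>\<^sup>2 * (c * \<mu> ^ k * real n + (\<mu> ^ k * real n)\<^sup>2)
    = (v + \<mu>\<^sup>2 * c) * \<mu> ^ k * real n + (\<mu> ^ Suc k * real n)\<^sup>2"
    by (simp add: power2_eq_square algebra_simps)
  also have "\<dots> = c * \<mu> ^ Suc k * real n + (\<mu> ^ Suc k * real n)\<^sup>2"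
    unfolding c(2) by (simp add: mult_ac)
  finally show ?case unfolding c_def .
qed

text \<open>The expansion of the square, arranged so that no difference of extended nonnegative numbers occurs.\<close>

lemma centered_second_moment:
  fixes r :: "nat pmf"
  assumes mean: "(\<integral>\<^sup>+y. ennreal (real y) \<partial>r) = ennreal e" "0 \<le> e"
  shows "(\<integral>\<^sup>+y. ennreal ((real y - e)\<^sup>2) \<partial>r) + ennreal (2 * e\<^sup>2)
    = (\<integral>\<^sup>+y. ennreal ((real y)\<^sup>2) \<partial>r) + ennreal (e\<^sup>2)"
proof -
  have *: "ennreal ((real y - e)\<^sup>2) + ennreal (2 * e) * ennreal (real y) = ennreal ((real y)\<^sup>2) + ennreal (e\<^sup>2)" for y
  proof -
    have "ennreal ((real y - e)\<^sup>2) + ennreal (2 * e) * ennreal (real y) = ennreal ((real y - e)\<^sup>2 + 2 * e * real y)"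
      using mean by (simp flip: ennreal_plus ennreal_mult)
    also have "(real y - e)\<^sup>2 + 2 * e * real y = (real y)\<^sup>2 + e\<^sup>2"
      by (simp add: power2_eq_square algebra_simps)
    finally show ?thesis by simp
  qed
  have "(\<integral>\<^sup>+y. ennreal ((real y - e)\<^sup>2) \<partial>r) + ennreal (2 * e\<^sup>2)
      = (\<integral>\<^sup>+y. ennreal ((real y - e)\<^sup>2) + ennreal (2 * e) * ennreal (real y) \<partial>r)"
    using mean by (subst nn_integral_add, simp, simp, subst nn_integral_cmult, simp,
      simp add: power2_eq_square mult_ac flip: ennreal_mult)
  also have "\<dots> = (\<integral>\<^sup>+y. ennreal ((real y)\<^sup>2) \<partial>r) + ennreal (e\<^sup>2)"
    unfolding * by (simp add: nn_integral_add)
  finally show ?thesis .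
qed

lemma centered_second_moment_le:
  fixes r :: "nat pmf"
  assumes mean: "(\<integral>\<^sup>+y. ennreal (real y) \<partial>r) = ennreal e" "0 \<le> e"
    and sq: "(\<integral>\<^sup>+y. ennreal ((real y)\<^sup>2) \<partial>r) \<le> ennreal (V + e\<^sup>2)" "0 \<le> V"
  shows "(\<integral>\<^sup>+y. ennreal ((real y - e)\<^sup>2) \<partial>r) \<le> ennreal V"
proof -
  have "(\<integral>\<^sup>+y. ennreal ((real y - e)\<^sup>2) \<partial>r) + ennreal (2 * e\<^sup>2)
      \<le> ennreal (V + e\<^sup>2) + ennreal (e\<^sup>2)"
    unfolding centered_second_moment[OF mean] using sq by (intro add_right_mono)
  also have "\<dots> = ennreal V + ennreal (2 * e\<^sup>2)" using sq by (simp flip: ennreal_plus)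
  finally show ?thesis by (simp add: add.commute[of _ "ennreal (2 * e\<^sup>2)"] ennreal_add_left_cancel_le)
qed

lemma mean_sq_le_second_moment:
  fixes r :: "nat pmf"
  assumes "(\<integral>\<^sup>+y. ennreal (real y) \<partial>r) = ennreal e" "0 \<le> e"
    and "(\<integral>\<^sup>+y. ennreal ((real y)\<^sup>2) \<partial>r) = ennreal m" "0 \<le> m"
  shows "e\<^sup>2 \<le> m"
proof -
  have "ennreal (2 * e\<^sup>2) \<le> (\<integral>\<^sup>+y. ennreal ((real y - e)\<^sup>2) \<partial>r) + ennreal (2 * e\<^sup>2)" by simp
  also have "\<dots> = ennreal (m + e\<^sup>2)"
    using centered_second_moment[OF assms(1,2)] assms by simp
  finally show ?thesis using assms by (subst (asm) ennreal_le_iff) auto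
qed

text \<open>Shrinking the summands shifts the sum downwards. With \<open>f = min N\<close> this allows truncation when only
  the lower deviations of a sum matter.\<close>

lemma iid_sum_map_le:
  assumes f: "\<And>a. f a \<le> a" and g: "antimono (g :: nat \<Rightarrow> ennreal)"
  shows "(\<integral>\<^sup>+y. g y \<partial>iid_sum_pmf p n) \<le> (\<integral>\<^sup>+y. g y \<partial>iid_sum_pmf (map_pmf f p) n)"
  using g
proof (induction n arbitrary: g)
  case (Suc n)
  have "(\<integral>\<^sup>+y. g y \<partial>iid_sum_pmf p (Suc n)) \<le> (\<integral>\<^sup>+a. \<integral>\<^sup>+y. g (f a + y) \<partial>iid_sum_pmf p n \<partial>p)"
    using Suc.prems f by (auto intro!: nn_integral_mono antimonoD[OF Suc.prems])
  also have "\<dots> \<le> (\<integral>\<^sup>+a. \<integral>\<^sup>+y. g (f a + y) \<partial>iid_sum_pmf (map_pmf f p) n \<partial>p)"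
    by (intro nn_integral_mono Suc.IH antimonoI antimonoD[OF Suc.prems]) auto
  also have "\<dots> = (\<integral>\<^sup>+y. g y \<partial>iid_sum_pmf (map_pmf f p) (Suc n))" by simp
  finally show ?case .
qed simp

lemma truncated_mean_close:
  fixes p :: "nat pmf"
  assumes mean: "(\<integral>\<^sup>+a. ennreal (real a) \<partial>p) = ennreal \<mu>" and "0 \<le> \<mu>" "0 < e"
  obtains N \<mu>' where "(\<integral>\<^sup>+a. ennreal (real (min N a)) \<partial>p) = ennreal \<mu>'" "0 \<le> \<mu>'" "\<mu>' \<le> \<mu>" "\<mu> - \<mu>' \<le> e"
proof -
  have le: "(\<integral>\<^sup>+a. ennreal (real (min N a)) \<partial>p) \<le> ennreal \<mu>" for N
    unfolding mean[symmetric] by (intro nn_integral_mono) auto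
  have "(\<lambda>N. \<integral>\<^sup>+a. ennreal (real (min N a)) \<partial>p) \<longlonglongrightarrow> (\<integral>\<^sup>+a. ennreal (real a) \<partial>p)"
  proof (rule nn_integral_LIMSEQ)
    show "incseq (\<lambda>N a. ennreal (real (min N a)))" by (auto simp: incseq_def le_fun_def min_def)
    show "(\<lambda>N. ennreal (real (min N a))) \<longlonglongrightarrow> ennreal (real a)" for a
      by (intro tendsto_eventually eventually_sequentiallyI[of a]) (simp add: min_def)
  qed auto
  then have lim: "(\<lambda>N. enn2real (\<integral>\<^sup>+a. ennreal (real (min N a)) \<partial>p)) \<longlonglongrightarrow> \<mu>"
    using assms by (auto dest: tendsto_enn2real[rotated])
  have "\<forall>\<^sub>F N in sequentially. \<mu> - e < enn2real (\<integral>\<^sup>+a. ennreal (real (min N a)) \<partial>p)"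
    using assms by (intro order_tendstoD(1)[OF lim]) auto
  then obtain N where N: "\<mu> - e < enn2real (\<integral>\<^sup>+a. ennreal (real (min N a)) \<partial>p)"
    by (meson eventually_sequentially order_refl)
  show thesis
    using le[of N] N assms(2)
    by (intro that[of N "enn2real (\<integral>\<^sup>+a. ennreal (real (min N a)) \<partial>p)"])
       (auto simp: enn2real_nonneg top_unique enn2real_leI ennreal_enn2real_if)
qed

text \<open>A weak law in \<open>L\<^sup>1\<close> under a first moment alone. The deviation \<open>S - n \<mu>\<close> has mean zero, so its
  absolute value has twice the mean of its negative part. The mean of the negative part only grows when the
  summands are truncated at a level \<open>N\<close>, and the truncated summands have a second moment; if \<open>N\<close> is large, they
  have nearly the original mean.\<close>

lemma wlln_iid_sum:
  fixes p :: "nat pmf"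
  assumes mean: "(\<integral>\<^sup>+a. ennreal (real a) \<partial>p) = ennreal \<mu>" "0 \<le> \<mu>" and "0 < e"
  obtains D where "D \<ge> 0"
    "\<And>n. (\<integral>\<^sup>+y. ennreal \<bar>real y - real n * \<mu>\<bar> \<partial>iid_sum_pmf p n) \<le> ennreal (e * real n + D)"
proof -
  obtain N m where m: "(\<integral>\<^sup>+a. ennreal (real (min N a)) \<partial>p) = ennreal m" "0 \<le> m" "m \<le> \<mu>" "\<mu> - m \<le> e / 4"
    using truncated_mean_close[OF mean, of "e/4"] assms by auto
  define p' where "p' = map_pmf (min N) p"
  have m': "(\<integral>\<^sup>+a. ennreal (real a) \<partial>p') = ennreal m" using m by (simp add: p'_def)
  define s where "s = (real N)\<^sup>2"
  have "(\<integral>\<^sup>+a. ennreal ((real a)\<^sup>2) \<partial>p') = (\<integral>\<^sup>+a. ennreal ((real (min N a))\<^sup>2) \<partial>p)"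
    by (simp add: p'_def)
  also have "\<dots> \<le> (\<integral>\<^sup>+a. ennreal s \<partial>p)"
    unfolding s_def by (intro nn_integral_mono ennreal_leI power_mono) auto
  finally have "(\<integral>\<^sup>+a. ennreal ((real a)\<^sup>2) \<partial>p') \<le> ennreal s" by simp
  then obtain m2 where m2: "(\<integral>\<^sup>+a. ennreal ((real a)\<^sup>2) \<partial>p') = ennreal m2" "0 \<le> m2" "m2 \<le> s"
    by (cases "\<integral>\<^sup>+a. ennreal ((real a)\<^sup>2) \<partial>p'" rule: ennreal_cases)
       (auto simp: s_def top_unique)
  have var: "m\<^sup>2 \<le> m2" by (rule mean_sq_le_second_moment[OF m' m(2) m2(1,2)])
  define v where "v = m2 - m\<^sup>2"
  have v: "0 \<le> v" "v \<le> s" "v + m\<^sup>2 = m2" using var m2(2,3) zero_le_power2[of m] unfolding v_def by linarith+ 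
  define h where "h = e / (4 * (s + 1))"
  have h: "h > 0" "h * v \<le> e / 4"
  proof -
    have s: "s \<ge> 0" by (simp add: s_def)
    show "h > 0" using assms s by (simp add: h_def)
    have "e * v \<le> e * (s + 1)" using v assms by (intro mult_left_mono) auto
    then show "h * v \<le> e / 4" using s by (simp add: h_def field_simps)
  qed
  have bound: "(\<integral>\<^sup>+y. ennreal \<bar>real y - real n * \<mu>\<bar> \<partial>iid_sum_pmf p n) \<le> ennreal (e * real n + 2 / h)" for n
  proof -
    define M where "M = real n * \<mu>"
    have M0: "M \<ge> 0" using mean by (simp add: M_def)
    define J where "J = (\<integral>\<^sup>+y. ennreal (max 0 (M - real y)) \<partial>iid_sum_pmf p n)"
    \<comment> \<open>Integrate \<open>M + \<bar>y - M\<bar> = y + 2 max 0 (M - y)\<close> and cancel the mean \<open>M\<close> of \<open>y\<close>.\<close>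
    have "ennreal M + (\<integral>\<^sup>+y. ennreal \<bar>real y - M\<bar> \<partial>iid_sum_pmf p n)
      = (\<integral>\<^sup>+y. ennreal M + ennreal \<bar>real y - M\<bar> \<partial>iid_sum_pmf p n)"
      by (simp add: nn_integral_add)
    also have "\<dots> = (\<integral>\<^sup>+y. ennreal (real y) + 2 * ennreal (max 0 (M - real y)) \<partial>iid_sum_pmf p n)"
    proof (intro nn_integral_cong)
      fix y :: nat
      have "2 * ennreal (max 0 (M - real y)) = ennreal (2 * max 0 (M - real y))"
        by (simp add: ennreal_mult)
      then show "ennreal M + ennreal \<bar>real y - M\<bar> = ennreal (real y) + 2 * ennreal (max 0 (M - real y))"
        using M0 by (simp add: max_def flip: ennreal_plus)
    qed
    also have "\<dots> = ennreal M + 2 * J"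
      by (simp add: nn_integral_add nn_integral_cmult mean_iid_sum[OF mean] J_def M_def)
    finally have eq: "(\<integral>\<^sup>+y. ennreal \<bar>real y - M\<bar> \<partial>iid_sum_pmf p n) = 2 * J"
      by (simp add: ennreal_add_left_cancel)
    have "J \<le> (\<integral>\<^sup>+y. ennreal (max 0 (M - real y)) \<partial>iid_sum_pmf p' n)"
      unfolding J_def p'_def by (intro iid_sum_map_le antimonoI ennreal_leI) auto
    also have "\<dots> \<le> (\<integral>\<^sup>+y. ennreal (real n * (e / 4) + 1 / h) + ennreal h * ennreal ((real y - real n * m)\<^sup>2) \<partial>iid_sum_pmf p' n)"
    proof (intro nn_integral_mono)
      fix y :: nat
      define t where "t = real n * m - real y"
      \<comment> \<open>This trades the first absolute moment for a small multiple of the variance plus a constant independent of \<open>n\<close>.\<close>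
      have "t \<le> 1 / h + h * t\<^sup>2"
      proof (cases "t \<le> 1 / h")
        case True
        moreover have "0 \<le> h * t\<^sup>2" using h(1) by simp
        ultimately show ?thesis by linarith
      next
        case False
        have "0 < 1 / h" using h(1) by simp
        with False have t: "t > 0" by linarith
        have "1 \<le> h * t" using False h(1) by (simp add: not_le divide_less_eq mult.commute)
        then have "t * 1 \<le> t * (h * t)" using t by (intro mult_left_mono) auto
        moreover have "t * (h * t) = h * t\<^sup>2" by (simp add: power2_eq_square)
        ultimately show ?thesis using \<open>0 < 1 / h\<close> by linarith
      qed
      moreover have "real n * (\<mu> - m) \<le> real n * (e / 4)" using m by (intro mult_left_mono) auto
      ultimately have "M - real y \<le> real n * (e / 4) + 1 / h + h * t\<^sup>2"
        by (simp add: M_def t_def algebra_simps)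
      moreover have "0 \<le> real n * (e / 4) + 1 / h + h * t\<^sup>2" using h(1) assms by simp
      moreover have "t\<^sup>2 = (real y - real n * m)\<^sup>2" by (simp add: t_def power2_commute)
      ultimately show "ennreal (max 0 (M - real y))
        \<le> ennreal (real n * (e / 4) + 1 / h) + ennreal h * ennreal ((real y - real n * m)\<^sup>2)"
        using h(1) assms by (simp add: ennreal_leI flip: ennreal_plus ennreal_mult)
    qed
    also have "\<dots> = ennreal (real n * (e / 4) + 1 / h)
      + ennreal h * (\<integral>\<^sup>+y. ennreal ((real y - real n * m)\<^sup>2) \<partial>iid_sum_pmf p' n)"
      by (simp add: nn_integral_add nn_integral_cmult)
    also have "\<dots> \<le> ennreal (real n * (e / 4) + 1 / h) + ennreal h * ennreal (real n * v)"
    proof (intro add_left_mono mult_left_mono centered_second_moment_le)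
      show "(\<integral>\<^sup>+y. ennreal (real y) \<partial>iid_sum_pmf p' n) = ennreal (real n * m)"
        using mean_iid_sum[OF m'] m by simp
      show "(\<integral>\<^sup>+y. ennreal ((real y)\<^sup>2) \<partial>iid_sum_pmf p' n) \<le> ennreal (real n * v + (real n * m)\<^sup>2)"
        using second_moment_iid_sum[OF m' m(2), of v n] m2 v by simp
    qed (use m v in auto)
    also have "\<dots> \<le> ennreal (real n * (e / 2) + 1 / h)"
    proof -
      have "h * (real n * v) \<le> real n * (e / 4)"
        using mult_left_mono[OF h(2), of "real n"] by (simp add: mult_ac)
      then have "real n * (e / 4) + 1 / h + h * (real n * v) \<le> real n * (e / 2) + 1 / h" by linarith
      then show ?thesis using h(1) v assms by (simp add: ennreal_leI flip: ennreal_plus ennreal_mult)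
    qed
    finally have "2 * J \<le> 2 * ennreal (real n * (e / 2) + 1 / h)" by (intro mult_left_mono) auto
    also have "\<dots> = ennreal (2 * (real n * (e / 2) + 1 / h))"
      using h(1) assms by (subst ennreal_mult) auto
    also have "2 * (real n * (e / 2) + 1 / h) = e * real n + 2 / h" by (simp add: algebra_simps)
    finally show ?thesis unfolding eq[symmetric] M_def[symmetric] .
  qed
  show thesis by (rule that[of "2/h"]) (use h bound in auto)
qed

text \<open>The \<open>L\<^sup>1\<close> error of generation \<open>k + 1\<close> is at most \<open>\<mu>\<close> times the error of generation \<open>k\<close> plus the
  mean error of one more random sum, whose number of terms has mean \<open>\<mu>\<^sup>k n\<close>. Bounds of the form
  \<open>e n + D\<close> with arbitrarily small \<open>e\<close> are stable under this step, since they are affine in \<open>n\<close>.\<close>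

lemma wlln_gw:
  fixes p :: "nat pmf"
  assumes mean: "(\<integral>\<^sup>+a. ennreal (real a) \<partial>p) = ennreal \<mu>" "0 \<le> \<mu>" and "0 < e"
  shows "\<exists>D\<ge>0. \<forall>n. (\<integral>\<^sup>+y. ennreal \<bar>real y - \<mu> ^ k * real n\<bar> \<partial>gw_pmf p k n) \<le> ennreal (e * real n + D)"
  using \<open>0 < e\<close>
proof (induction k arbitrary: e)
  case 0
  then show ?case by (auto intro!: exI[of _ 0])
next
  case (Suc k)
  define e1 where "e1 = e / (2 * (\<mu> + 1))"
  define e2 where "e2 = e / (2 * (\<mu> ^ k + 1))"
  have mk: "\<mu> ^ k \<ge> 0" using mean by simp
  have e1: "e1 > 0" "\<mu> * e1 \<le> e / 2" using Suc mean by (auto simp: e1_def field_simps)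
  have e2: "e2 > 0" "\<mu> ^ k * e2 \<le> e / 2" using Suc mk
    by (auto simp: e2_def field_simps intro: add_nonneg_pos)
  obtain D1 where D1: "D1 \<ge> 0"
    "\<And>n. (\<integral>\<^sup>+y. ennreal \<bar>real y - \<mu> ^ k * real n\<bar> \<partial>gw_pmf p k n) \<le> ennreal (e1 * real n + D1)"
    using Suc.IH[OF e1(1)] by auto
  obtain D2 where D2: "D2 \<ge> 0"
    "\<And>n. (\<integral>\<^sup>+y. ennreal \<bar>real y - real n * \<mu>\<bar> \<partial>iid_sum_pmf p n) \<le> ennreal (e2 * real n + D2)"
    using wlln_iid_sum[OF mean e2(1)] by blast
  have "(\<integral>\<^sup>+y. ennreal \<bar>real y - \<mu> ^ Suc k * real n\<bar> \<partial>gw_pmf p (Suc k) n)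
      \<le> ennreal (e * real n + (D2 + \<mu> * D1))" for n
  proof -
    have "(\<integral>\<^sup>+y. ennreal \<bar>real y - \<mu> ^ Suc k * real n\<bar> \<partial>gw_pmf p (Suc k) n)
      \<le> (\<integral>\<^sup>+m. (\<integral>\<^sup>+y. ennreal \<bar>real y - real m * \<mu>\<bar> + ennreal \<mu> * ennreal \<bar>real m - \<mu> ^ k * real n\<bar> \<partial>iid_sum_pmf p m) \<partial>gw_pmf p k n)"
    proof (simp, intro nn_integral_mono)
      fix m y :: nat
      have "\<bar>real m * \<mu> - \<mu> * \<mu> ^ k * real n\<bar> = \<mu> * \<bar>real m - \<mu> ^ k * real n\<bar>"
        using mean by (simp add: abs_mult[symmetric] abs_mult_pos' algebra_simps)
      then have "\<bar>real y - \<mu> * \<mu> ^ k * real n\<bar> \<le> \<bar>real y - real m * \<mu>\<bar> + \<mu> * \<bar>real m - \<mu> ^ k * real n\<bar>"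
        by linarith
      then show "ennreal \<bar>real y - \<mu> * \<mu> ^ k * real n\<bar> \<le> ennreal \<bar>real y - real m * \<mu>\<bar> + ennreal \<mu> * ennreal \<bar>real m - \<mu> ^ k * real n\<bar>"
        using mean by (simp add: ennreal_leI flip: ennreal_plus ennreal_mult)
    qed
    also have "\<dots> \<le> (\<integral>\<^sup>+m. (ennreal e2 * ennreal (real m) + ennreal D2) + ennreal \<mu> * ennreal \<bar>real m - \<mu> ^ k * real n\<bar> \<partial>gw_pmf p k n)"
      using D2 e2(1) by (auto intro!: nn_integral_mono add_right_mono simp: nn_integral_add simp flip: ennreal_plus ennreal_mult)
    also have "\<dots> = ennreal e2 * ennreal (\<mu> ^ k * real n) + ennreal D2 + ennreal \<mu> * (\<integral>\<^sup>+m. ennreal \<bar>real m - \<mu> ^ k * real n\<bar> \<partial>gw_pmf p k n)"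
      by (simp add: nn_integral_add nn_integral_cmult mean_gw[OF mean])
    also have "\<dots> \<le> ennreal e2 * ennreal (\<mu> ^ k * real n) + ennreal D2 + ennreal \<mu> * ennreal (e1 * real n + D1)"
      by (intro add_left_mono mult_left_mono D1) auto
    also have "\<dots> = ennreal (e2 * (\<mu> ^ k * real n) + D2 + \<mu> * (e1 * real n + D1))"
      using D1(1) D2(1) e1(1) e2(1) mean mk by (simp flip: ennreal_plus ennreal_mult)
    also have "\<dots> \<le> ennreal (e * real n + (D2 + \<mu> * D1))"
      using mult_right_mono[OF e1(2), of "real n"] mult_right_mono[OF e2(2), of "real n"]
      by (intro ennreal_leI) (simp add: algebra_simps)
    finally show ?thesis .
  qed
  then show ?case using D1(1) D2(1) mean by (intro exI[of _ "D2 + \<mu> * D1"]) auto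
qed

lemma markov_pmf:
  fixes r :: "nat pmf" and h :: "nat \<Rightarrow> real"
  assumes "(\<integral>\<^sup>+y. ennreal (h y) \<partial>r) \<le> ennreal E" "0 \<le> E" "0 < t" "\<And>y. y \<in> S \<Longrightarrow> t \<le> h y"
  shows "measure_pmf.prob r S \<le> E / t"
proof -
  have "ennreal t * emeasure r S = (\<integral>\<^sup>+y. ennreal t * indicator S y \<partial>r)"
    by (simp add: nn_integral_cmult)
  also have "\<dots> \<le> (\<integral>\<^sup>+y. ennreal (h y) \<partial>r)"
    using assms by (intro nn_integral_mono) (auto simp: indicator_def intro!: ennreal_leI)
  also have "\<dots> \<le> ennreal E" by fact
  finally have "t * measure_pmf.prob r S \<le> E"
    using assms by (simp add: measure_pmf.emeasure_eq_measure flip: ennreal_mult)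
  then show ?thesis using assms by (simp add: field_simps)
qed

lemma gw_concentration:
  fixes p :: "nat pmf"
  assumes mean: "(\<integral>\<^sup>+a. ennreal (real a) \<partial>p) = ennreal \<mu>" "0 \<le> \<mu>" and "0 < d" "0 < e"
  obtains N where "N > 0"
    "\<And>n. real n \<ge> N \<Longrightarrow> measure_pmf.prob (gw_pmf p k n) {y. d * real n \<le> \<bar>real y - \<mu> ^ k * real n\<bar>} \<le> e"
proof -
  have "0 < d * e / 2" using assms by simp
  then obtain D where D: "D \<ge> 0"
    "\<And>n. (\<integral>\<^sup>+y. ennreal \<bar>real y - \<mu> ^ k * real n\<bar> \<partial>gw_pmf p k n) \<le> ennreal (d * e / 2 * real n + D)"
    using wlln_gw[OF mean, of "d * e / 2" k] by auto
  show thesis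
  proof (rule that[of "2 * D / (d * e) + 1"])
    show "2 * D / (d * e) + 1 > 0" using D(1) assms by (simp add: add_nonneg_pos)
    fix n :: nat assume n: "real n \<ge> 2 * D / (d * e) + 1"
    have n0: "real n > 0" using n D(1) assms by (smt (verit) divide_nonneg_nonneg mult_nonneg_nonneg)
    have De: "D \<le> d * e / 2 * real n" using n assms
      by (simp add: field_simps) (smt (verit) mult_pos_pos)
    let ?S = "{y. d * real n \<le> \<bar>real y - \<mu> ^ k * real n\<bar>}"
    have "measure_pmf.prob (gw_pmf p k n) ?S \<le> (d * e / 2 * real n + D) / (d * real n)"
      by (rule markov_pmf[OF D(2)]) (use n0 D(1) assms in auto)
    also have "\<dots> \<le> (d * real n * e) / (d * real n)"
      using De n0 assms by (intro divide_right_mono) (auto simp: algebra_simps)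
    finally show "measure_pmf.prob (gw_pmf p k n) ?S \<le> e" using n0 assms by simp
  qed
qed

section \<open>The tail of one generation started from a heavy-tailed population\<close>

locale gw_tail = rv_tail F \<alpha> for F :: "real \<Rightarrow> real" and \<alpha> :: real +
  fixes p q :: "nat pmf" and \<mu> :: real
  assumes F_eq: "\<And>x. F x = measure_pmf.prob q {n. x < real n}"
    and mean: "(\<integral>\<^sup>+a. ennreal (real a) \<partial>p) = ennreal \<mu>"
    and mu: "0 < \<mu>" "\<mu> < 1"
    and alpha_less: "\<alpha> < 2"
    and square: "1 \<le> \<alpha> \<Longrightarrow> \<exists>v\<ge>0. (\<integral>\<^sup>+a. ennreal ((real a)\<^sup>2) \<partial>p) = ennreal (v + \<mu>\<^sup>2)"
begin

lemma mu_powr_less_1: "s > 0 \<Longrightarrow> \<mu> powr s < 1"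
  using powr_less_mono2[of s \<mu> 1] mu by simp

definition gw_exceed :: "nat \<Rightarrow> nat \<Rightarrow> real \<Rightarrow> real" where
  "gw_exceed k n x = measure_pmf.prob (gw_pmf p k n) {y. x < real y}"

text \<open>This is the tail of \<open>C\<^sub>k\<close>: the process is started from a variable with the law \<open>q\<close> of \<open>B\<close>.\<close>

definition C_exceed :: "nat \<Rightarrow> real \<Rightarrow> real" where
  "C_exceed k x = measure_pmf.prob (bind_pmf q (gw_pmf p k)) {y. x < real y}"

definition trunc_mean :: "real \<Rightarrow> real" where
  "trunc_mean z = measure_pmf.expectation q (\<lambda>n. real n * indicator {n. real n \<le> z} n)"

lemma gw_exceed_bounds: "0 \<le> gw_exceed k n x" "gw_exceed k n x \<le> 1"
  by (auto simp: gw_exceed_def)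

lemma integrable_q_bounded:
  fixes h :: "nat \<Rightarrow> real"
  assumes "\<And>n. 0 \<le> h n" "\<And>n. h n \<le> c"
  shows "integrable (measure_pmf q) h"
  using assms by (intro measure_pmf.integrable_const_bound[where B = c]) auto

lemma integrable_q [simp]:
  "integrable (measure_pmf q) (\<lambda>n. gw_exceed k n x)"
  "integrable (measure_pmf q) (\<lambda>n. indicator {n. z < real n} n :: real)"
  "integrable (measure_pmf q) (\<lambda>n. real n * indicator {n. real n \<le> z} n)"
proof -
  show "integrable (measure_pmf q) (\<lambda>n. gw_exceed k n x)"
    by (rule integrable_q_bounded[of _ 1]) (auto simp: gw_exceed_bounds)
  show "integrable (measure_pmf q) (\<lambda>n. indicator {n. z < real n} n :: real)"
    by (rule integrable_q_bounded[of _ 1]) (auto simp: indicator_def)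
  show "integrable (measure_pmf q) (\<lambda>n. real n * indicator {n. real n \<le> z} n)"
    by (rule integrable_q_bounded[of _ "max z 0"]) (auto simp: indicator_def)
qed

lemma C_exceed_eq: "C_exceed k x = measure_pmf.expectation q (\<lambda>n. gw_exceed k n x)"
proof -
  have "ennreal (C_exceed k x) = (\<integral>\<^sup>+n. ennreal (gw_exceed k n x) \<partial>q)"
    unfolding C_exceed_def gw_exceed_def measure_pmf.emeasure_eq_measure[symmetric] by simp
  also have "\<dots> = ennreal (measure_pmf.expectation q (\<lambda>n. gw_exceed k n x))"
    by (intro nn_integral_eq_integral) (auto simp: gw_exceed_bounds)
  finally show ?thesis
    by (subst (asm) ennreal_inj) (auto simp: C_exceed_def gw_exceed_bounds intro!: integral_nonneg_AE)
qed

lemma C_exceed_le: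
  assumes "\<And>n. gw_exceed k n x \<le> a * (real n * indicator {n. real n \<le> z} n)
      + (b * indicator {n. z1 < real n} n + indicator {n. z2 < real n} n)"
  shows "C_exceed k x \<le> a * trunc_mean z + (b * F z1 + F z2)"
proof -
  have "C_exceed k x \<le> measure_pmf.expectation q (\<lambda>n. a * (real n * indicator {n. real n \<le> z} n)
      + (b * indicator {n. z1 < real n} n + indicator {n. z2 < real n} n))"
    unfolding C_exceed_eq using assms by (intro integral_mono) auto
  then show ?thesis by (simp add: trunc_mean_def F_eq)
qed

lemma C_exceed_ge:
  assumes "\<And>n. b * indicator {n. z < real n} n \<le> gw_exceed k n x"
  shows "b * F z \<le> C_exceed k x"
proof -
  have "measure_pmf.expectation q (\<lambda>n. b * indicator {n. z < real n} n) \<le> C_exceed k x"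
    unfolding C_exceed_eq using assms by (intro integral_mono) auto
  then show ?thesis by (simp add: F_eq)
qed

lemma trunc_mean_le: "z > 0 \<Longrightarrow> trunc_mean z \<le> z"
proof -
  assume z: "z > 0"
  have "trunc_mean z \<le> measure_pmf.expectation q (\<lambda>_. z)"
    unfolding trunc_mean_def
    by (rule integral_mono, simp, simp, use z in \<open>auto simp: indicator_def\<close>)
  then show ?thesis by simp
qed

lemma trunc_mean_double: "z > 0 \<Longrightarrow> trunc_mean (2 * z) \<le> trunc_mean z + 2 * z * F z"
proof -
  assume z: "z > 0"
  have "trunc_mean (2 * z) \<le> measure_pmf.expectation q
     (\<lambda>n. real n * indicator {n. real n \<le> z} n + 2 * z * indicator {n. z < real n} n)"
    unfolding trunc_mean_def
    by (rule integral_mono, simp, simp, use z in \<open>auto simp: indicator_def\<close>)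
  then show ?thesis by (simp add: trunc_mean_def F_eq)
qed

lemma trunc_mean_nonneg: "0 \<le> trunc_mean z"
  unfolding trunc_mean_def by (intro integral_nonneg_AE) auto

lemma gw_exceed_markov:
  assumes "x > 0"
  shows "gw_exceed k n x \<le> \<mu> ^ k / x * real n"
proof -
  have "gw_exceed k n x \<le> (\<mu> ^ k * real n) / x"
    unfolding gw_exceed_def using assms mu by (intro markov_pmf[where h = real]) (auto simp: mean_gw[OF mean])
  then show ?thesis by simp
qed

lemma gw_exceed_chebyshev:
  assumes "1 \<le> \<alpha>"
  obtains c where "c \<ge> 0" "\<And>k n x. x > 0 \<Longrightarrow> \<mu> ^ k * real n \<le> x / 2 \<Longrightarrow> gw_exceed k n x \<le> c * \<mu> ^ k / x\<^sup>2 * real n"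
proof -
  obtain v where v: "v \<ge> 0" "(\<integral>\<^sup>+a. ennreal ((real a)\<^sup>2) \<partial>p) = ennreal (v + \<mu>\<^sup>2)"
    using square[OF assms] by auto
  have m: "\<mu> - \<mu>\<^sup>2 > 0" using mu by (simp add: power2_eq_square)
  show thesis
  proof (rule that[of "4 * (v / (\<mu> - \<mu>\<^sup>2))"])
    fix k n x assume x: "(x::real) > 0" and n: "\<mu> ^ k * real n \<le> x / 2"
    have "(\<integral>\<^sup>+y. ennreal ((real y - \<mu> ^ k * real n)\<^sup>2) \<partial>gw_pmf p k n) \<le> ennreal (v / (\<mu> - \<mu>\<^sup>2) * \<mu> ^ k * real n)"
      using mu v m by (intro centered_second_moment_le mean_gw[OF mean] second_moment_gw[OF mean mu v(2,1)]) auto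
    then have "gw_exceed k n x \<le> (v / (\<mu> - \<mu>\<^sup>2) * \<mu> ^ k * real n) / (x / 2)\<^sup>2"
      unfolding gw_exceed_def
    proof (rule markov_pmf)
      show "(x / 2)\<^sup>2 \<le> (real y - \<mu> ^ k * real n)\<^sup>2" if "y \<in> {y. x < real y}" for y
        using that n x by (intro power_mono) auto
    qed (use x v m mu in auto)
    then show "gw_exceed k n x \<le> 4 * (v / (\<mu> - \<mu>\<^sup>2)) * \<mu> ^ k / x\<^sup>2 * real n"
      by (simp add: power_divide mult_ac)
  qed (use v m in auto)
qed

text \<open>The overshoots \<open>C\<^sub>k > x\<close> that stem from a start \<open>B \<le> \<eta> x\<close> are negligible. For \<open>\<alpha> < 1\<close>, Markov's
  inequality and \<open>E[B; B \<le> z] = O(z F z)\<close> bound them by a multiple of \<open>\<eta> powr (1 - \<alpha>) * F x\<close>,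
  which is small for small \<open>\<eta>\<close>. For \<open>\<alpha> \<ge> 1\<close>, Chebyshev's inequality gives the order
  \<open>x powr (-(1 + \<alpha>/2))\<close>, and \<open>1 + \<alpha>/2 > \<alpha>\<close>, so that already \<open>\<eta> = 1/2\<close> will do. The function
  \<open>A\<close> is the factor of \<open>n\<close> in the respective inequality.\<close>

lemma small_start:
  assumes "e > 0"
  obtains \<eta> A where "\<eta> > 0" "\<And>x. x > 0 \<Longrightarrow> A x \<ge> 0"
    "\<And>x n. x > 0 \<Longrightarrow> real n \<le> \<eta> * x \<Longrightarrow> gw_exceed k n x \<le> A x * real n"
    "\<forall>\<^sub>F x in at_top. A x * trunc_mean (\<eta> * x) \<le> e * F x"
proof (cases "\<alpha> < 1")
  case True
  obtain c x0 where c: "c > 0" "x0 > 0" "\<And>z. z \<ge> x0 \<Longrightarrow> trunc_mean z \<le> c * (z * F z)"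
    by (rule truncated_mean_le_tail[OF trunc_mean_le trunc_mean_double True]; blast)
  have "((\<lambda>\<eta>. 2 * c * \<eta> powr (1 - \<alpha>)) \<longlongrightarrow> 2 * c * 0) (at_right 0)"
    using True by (intro tendsto_intros tendsto_zero_powrI)
      (auto intro: eventually_mono[OF eventually_at_right_less])
  then have "\<forall>\<^sub>F \<eta> in at_right 0. 2 * c * \<eta> powr (1 - \<alpha>) < e"
    using assms order_tendstoD(2) by fastforce
  then have "\<forall>\<^sub>F \<eta> in at_right 0. 2 * c * \<eta> powr (1 - \<alpha>) < e \<and> \<eta> > (0::real)"
    using eventually_at_right_less by (rule eventually_conj)
  from eventually_happens'[OF trivial_limit_at_right_real this]
  obtain \<eta> :: real where \<eta>: "\<eta> > 0" "2 * c * \<eta> powr (1 - \<alpha>) < e"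
    by auto
  show thesis
  proof (rule that[of \<eta> "\<lambda>x. \<mu> ^ k / x"])
    have "\<forall>\<^sub>F x in at_top. F (\<eta> * x) \<le> 2 * \<eta> powr (-\<alpha>) * F x"
      using \<eta>(1) by (intro eventually_scaled_le) auto
    then show "\<forall>\<^sub>F x in at_top. \<mu> ^ k / x * trunc_mean (\<eta> * x) \<le> e * F x"
      using eventually_ge_at_top[of "x0 / \<eta>"] eventually_gt_at_top[of 0]
    proof eventually_elim
      case (elim x)
      have "\<mu> ^ k / x * trunc_mean (\<eta> * x) \<le> 1 / x * (c * (\<eta> * x * F (\<eta> * x)))"
        using elim \<eta> mu c(2) trunc_mean_nonneg by (intro mult_mono c(3) divide_right_mono power_le_one)
          (auto simp: field_simps)
      also have "\<dots> = c * \<eta> * F (\<eta> * x)" using elim by simp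
      also have "\<dots> \<le> c * \<eta> * (2 * \<eta> powr (-\<alpha>) * F x)" using elim c(1) \<eta>(1) by simp
      also have "\<dots> = (2 * c * (\<eta> * \<eta> powr (-\<alpha>))) * F x" by simp
      also have "\<eta> * \<eta> powr (-\<alpha>) = \<eta> powr (1 - \<alpha>)" using powr_mult_base[of \<eta> "-\<alpha>"] \<eta>(1) by simp
      also have "2 * c * \<eta> powr (1 - \<alpha>) * F x \<le> e * F x"
        using \<eta>(2) pos[of x] by (intro mult_right_mono) auto
      finally show ?case .
    qed
  qed (use \<eta> mu gw_exceed_markov in auto)
next
  case False
  then have a1: "1 \<le> \<alpha>" by simp
  obtain c where c: "c \<ge> 0" "\<And>k n x. x > 0 \<Longrightarrow> \<mu> ^ k * real n \<le> x / 2 \<Longrightarrow> gw_exceed k n x \<le> c * \<mu> ^ k / x\<^sup>2 * real n"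
    by (rule gw_exceed_chebyshev[OF a1], blast)
  obtain d x0 where d: "d > 0" "x0 > 0" "\<And>z. z \<ge> x0 \<Longrightarrow> trunc_mean z \<le> d * z powr (1 - \<alpha> / 2)"
    by (rule truncated_mean_le_powr[OF trunc_mean_le trunc_mean_double alpha_less]; blast)
  show thesis
  proof (rule that[of "1/2" "\<lambda>x. c / x\<^sup>2"])
    fix x :: real and n assume x: "x > 0" and n: "real n \<le> 1 / 2 * x"
    have "\<mu> ^ k * real n \<le> 1 * real n" using mu by (intro mult_right_mono power_le_one) auto
    then have "gw_exceed k n x \<le> c * \<mu> ^ k / x\<^sup>2 * real n" using x n by (intro c(2)) auto
    also have "\<dots> \<le> c * 1 / x\<^sup>2 * real n" using mu c(1)
      by (intro mult_right_mono divide_right_mono mult_left_mono power_le_one) auto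
    finally show "gw_exceed k n x \<le> c / x\<^sup>2 * real n" by simp
  next
    have "\<forall>\<^sub>F x in at_top. x powr (-(1 + \<alpha>/2)) \<le> e / (c * d + 1) * F x"
      using alpha_less assms c(1) d(1) by (intro powr_smallo) (auto simp: add_nonneg_pos)
    then show "\<forall>\<^sub>F x in at_top. c / x\<^sup>2 * trunc_mean (1/2 * x) \<le> e * F x"
      using eventually_ge_at_top[of "2 * x0"] eventually_gt_at_top[of 0]
    proof eventually_elim
      case (elim x)
      have cd: "c * d \<ge> 0" using c(1) d(1) by simp
      have "c / x\<^sup>2 * trunc_mean (1/2 * x) \<le> c / x\<^sup>2 * (d * (1/2 * x) powr (1 - \<alpha>/2))"
        using elim c(1) by (intro mult_left_mono d(3)) auto
      also have "\<dots> \<le> c / x\<^sup>2 * (d * x powr (1 - \<alpha>/2))"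
        using elim c(1) d(1) alpha_less by (intro mult_left_mono powr_mono2) auto
      also have "\<dots> = c * d * (x powr (1 - \<alpha>/2) * x powr (-2))"
        using elim powr_neg_numeral[of x "num.Bit0 num.One"] by simp
      also have "x powr (1 - \<alpha>/2) * x powr (-2) = x powr (-(1 + \<alpha>/2))"
        by (simp add: powr_add[symmetric])
      also have "c * d * x powr (-(1 + \<alpha>/2)) \<le> (c * d + 1) * (e / (c * d + 1) * F x)"
        using elim cd by (intro mult_mono) auto
      also have "\<dots> = e * F x" using cd by simp
      finally show ?case .
    qed
  qed (use c in auto)
qed

text \<open>The start \<open>B\<close> is either at most \<open>\<eta> x\<close>, or above \<open>(1 - \<epsilon>) x / \<mu>\<^sup>k\<close>, or in between. The first case is
  negligible by \<open>small_start\<close>. In the last case \<open>B\<close> is large, and the generation has to exceed its mean by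
  a fixed proportion, which is unlikely by the weak law.\<close>

lemma C_exceed_upper:
  assumes "0 < \<epsilon>" "\<epsilon> < 1" "0 < e"
  shows "\<forall>\<^sub>F x in at_top. C_exceed k x \<le> e * F x + F ((1 - \<epsilon>) / \<mu> ^ k * x)"
proof -
  have e2: "e / 2 > 0" using assms by simp
  obtain \<eta> A where A: "\<eta> > 0" "\<And>x. x > 0 \<Longrightarrow> A x \<ge> 0"
    "\<And>x n. x > 0 \<Longrightarrow> real n \<le> \<eta> * x \<Longrightarrow> gw_exceed k n x \<le> A x * real n"
    "\<forall>\<^sub>F x in at_top. A x * trunc_mean (\<eta> * x) \<le> e / 2 * F x"
    by (rule small_start[OF e2, of k], blast)
  \<comment> \<open>Chosen so that the in-between case costs at most \<open>b * F (\<eta> x) \<le> e / 2 * F x\<close>.\<close>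
  define b where "b = e / (4 * \<eta> powr (-\<alpha>))"
  have b: "b > 0" using A(1) assms by (simp add: b_def)
  have mk: "\<mu> ^ k > 0" using mu by simp
  have d: "\<epsilon> * \<mu> ^ k > 0" using assms mk by simp
  obtain N where N: "N > 0" "\<And>n. real n \<ge> N \<Longrightarrow>
      measure_pmf.prob (gw_pmf p k n) {y. \<epsilon> * \<mu> ^ k * real n \<le> \<bar>real y - \<mu> ^ k * real n\<bar>} \<le> b"
    by (rule gw_concentration[OF mean less_imp_le[OF mu(1)] d b, of k], blast)
  have "\<forall>\<^sub>F x in at_top. F (\<eta> * x) \<le> 2 * \<eta> powr (-\<alpha>) * F x"
    using A(1) by (intro eventually_scaled_le) auto
  then show ?thesis
    using A(4) eventually_gt_at_top[of 0] eventually_ge_at_top[of "N / \<eta>"]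
  proof eventually_elim
    case (elim x)
    have "C_exceed k x \<le> A x * trunc_mean (\<eta> * x) + (b * F (\<eta> * x) + F ((1 - \<epsilon>) / \<mu> ^ k * x))"
    proof (rule C_exceed_le)
      fix n
      consider "real n \<le> \<eta> * x" | "real n > (1 - \<epsilon>) / \<mu> ^ k * x" "real n > \<eta> * x"
        | "\<eta> * x < real n" "real n \<le> (1 - \<epsilon>) / \<mu> ^ k * x" by linarith
      then show "gw_exceed k n x \<le> A x * (real n * indicator {n. real n \<le> \<eta> * x} n) +
          (b * indicator {n. \<eta> * x < real n} n + indicator {n. (1 - \<epsilon>) / \<mu> ^ k * x < real n} n)"
      proof cases
        case 1
        have "gw_exceed k n x \<le> A x * real n" using A(3) elim 1 by blast
        then show ?thesis using 1 b by (simp add: indicator_def)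
      next
        case 2
        then show ?thesis using b gw_exceed_bounds(2)[of k n x] by (simp add: indicator_def)
      next
        case 3
        have "real n \<ge> N" using elim 3 A(1) by (simp add: field_simps)
        have "gw_exceed k n x \<le> measure_pmf.prob (gw_pmf p k n) {y. \<epsilon> * \<mu> ^ k * real n \<le> \<bar>real y - \<mu> ^ k * real n\<bar>}"
          unfolding gw_exceed_def
        proof (rule measure_pmf.finite_measure_mono)
          have le: "\<mu> ^ k * real n \<le> (1 - \<epsilon>) * x" using 3 mk by (simp add: field_simps)
          have "(1 - \<epsilon>) * x \<le> x" using elim assms by (simp add: mult_le_cancel_right1)
          then have "\<mu> ^ k * real n \<le> x" using le by simp
          then have "\<epsilon> * (\<mu> ^ k * real n) \<le> \<epsilon> * x" using assms by (intro mult_left_mono) auto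
          with le show "{y. x < real y} \<subseteq> {y. \<epsilon> * \<mu> ^ k * real n \<le> \<bar>real y - \<mu> ^ k * real n\<bar>}"
            by (auto simp: algebra_simps)
        qed simp
        also have "\<dots> \<le> b" using N(2) \<open>real n \<ge> N\<close> by blast
        finally show ?thesis using 3 by (simp add: indicator_def)
      qed
    qed
    also have "\<dots> \<le> e / 2 * F x + (b * (2 * \<eta> powr (-\<alpha>) * F x) + F ((1 - \<epsilon>) / \<mu> ^ k * x))"
      using elim b by (intro add_mono mult_left_mono) auto
    also have "b * (2 * \<eta> powr (-\<alpha>) * F x) = e / 2 * F x"
      using A(1) by (simp add: b_def)
    finally show ?case by simp
  qed
qed

lemma C_exceed_lower:
  assumes "0 < \<epsilon>" "0 < e"
  shows "\<forall>\<^sub>F x in at_top. (1 - e) * F ((1 + \<epsilon>) / \<mu> ^ k * x) \<le> C_exceed k x"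
proof -
  have mk: "\<mu> ^ k > 0" using mu by simp
  \<comment> \<open>A start \<open>n > (1 + \<epsilon>) x / \<mu>\<^sup>k\<close> has \<open>x < \<mu>\<^sup>k n / (1 + \<epsilon>) = \<mu>\<^sup>k n - d n\<close>.\<close>
  define d where "d = \<epsilon> / (1 + \<epsilon>) * \<mu> ^ k"
  have d: "d > 0" using assms mk by (simp add: d_def)
  obtain N where N: "N > 0" "\<And>n. real n \<ge> N \<Longrightarrow>
      measure_pmf.prob (gw_pmf p k n) {y. d * real n \<le> \<bar>real y - \<mu> ^ k * real n\<bar>} \<le> e"
    by (rule gw_concentration[OF mean less_imp_le[OF mu(1)] d assms(2), of k], blast)
  have c0: "(1 + \<epsilon>) / \<mu> ^ k > 0" using assms mk by simp
  show ?thesis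
    using eventually_ge_at_top[of "N / ((1 + \<epsilon>) / \<mu> ^ k)"] eventually_gt_at_top[of 0]
  proof eventually_elim
    case (elim x)
    show ?case
    proof (rule C_exceed_ge)
      fix n
      show "(1 - e) * indicator {n. (1 + \<epsilon>) / \<mu> ^ k * x < real n} n \<le> gw_exceed k n x"
      proof (cases "(1 + \<epsilon>) / \<mu> ^ k * x < real n")
        case True
        have "N \<le> (1 + \<epsilon>) / \<mu> ^ k * x" using elim(1) c0 by (subst (asm) pos_divide_le_eq) (auto simp: mult.commute)
        then have "real n \<ge> N" using True by linarith
        let ?S = "{y. d * real n \<le> \<bar>real y - \<mu> ^ k * real n\<bar>}"
        have "1 - e \<le> 1 - measure_pmf.prob (gw_pmf p k n) ?S"
          using N(2) \<open>real n \<ge> N\<close> by simp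
        also have "\<dots> = measure_pmf.prob (gw_pmf p k n) (UNIV - ?S)"
          using measure_pmf.prob_compl[of ?S "gw_pmf p k n"] by simp
        also have "\<dots> \<le> gw_exceed k n x"
          unfolding gw_exceed_def
        proof (rule measure_pmf.finite_measure_mono)
          have "(1 + \<epsilon>) * x \<le> \<mu> ^ k * real n" using True mk by (simp add: field_simps)
          then have "x \<le> \<mu> ^ k * real n / (1 + \<epsilon>)" using assms by (simp add: field_simps)
          also have "\<mu> ^ k * real n / (1 + \<epsilon>) = \<mu> ^ k * real n - d * real n"
            using assms by (simp add: d_def field_simps)
          finally show "UNIV - ?S \<subseteq> {y. x < real y}" by auto
        qed simp
        finally show ?thesis using True by simp
      qed (simp add: gw_exceed_bounds)
    qed
  qed
qed

lemma C_exceed_asymp: "((\<lambda>x. C_exceed k x / F x) \<longlongrightarrow> \<mu> powr (real k * \<alpha>)) at_top"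
proof -
  have mk: "\<mu> ^ k > 0" using mu by simp
  have lim0: "(1 / \<mu> ^ k) powr (-\<alpha>) = \<mu> powr (real k * \<alpha>)"
    using mu by (simp add: powr_divide powr_minus powr_powr flip: powr_realpow)
  show ?thesis
  proof (rule order_tendstoI)
    fix l assume l: "l < \<mu> powr (real k * \<alpha>)"
    have "((\<lambda>\<epsilon>. (1 - \<epsilon>) * (((1 + \<epsilon>) / \<mu> ^ k) powr (-\<alpha>) - \<epsilon>)) \<longlongrightarrow> (1 - 0) * (((1 + 0) / \<mu> ^ k) powr (-\<alpha>) - 0)) (at_right 0)"
      using mu by (intro tendsto_intros) auto
    then have "\<forall>\<^sub>F \<epsilon> in at_right 0. l < (1 - \<epsilon>) * (((1 + \<epsilon>) / \<mu> ^ k) powr (-\<alpha>) - \<epsilon>)"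
      using l lim0 by (intro order_tendstoD(1)) auto
    moreover have "\<forall>\<^sub>F \<epsilon> in at_right (0::real). \<epsilon> \<in> {0<..<1}"
      by (rule eventually_at_right_real) simp
    ultimately have "\<forall>\<^sub>F \<epsilon> in at_right 0. l < (1 - \<epsilon>) * (((1 + \<epsilon>) / \<mu> ^ k) powr (-\<alpha>) - \<epsilon>) \<and> \<epsilon> \<in> {0<..<1}"
      by (rule eventually_conj)
    from eventually_happens'[OF trivial_limit_at_right_real this]
    obtain \<epsilon> :: real where \<epsilon>: "0 < \<epsilon>" "\<epsilon> < 1" "l < (1 - \<epsilon>) * (((1 + \<epsilon>) / \<mu> ^ k) powr (-\<alpha>) - \<epsilon>)"
      by auto
    have "\<forall>\<^sub>F x in at_top. (((1 + \<epsilon>) / \<mu> ^ k) powr (-\<alpha>) - \<epsilon>) * F x \<le> F ((1 + \<epsilon>) / \<mu> ^ k * x)"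
      using \<epsilon> mk by (intro eventually_scaled_ge) auto
    with C_exceed_lower[OF \<epsilon>(1,1), of k] show "\<forall>\<^sub>F x in at_top. l < C_exceed k x / F x"
    proof eventually_elim
      case (elim x)
      have "l * F x < (1 - \<epsilon>) * (((1 + \<epsilon>) / \<mu> ^ k) powr (-\<alpha>) - \<epsilon>) * F x"
        using \<epsilon> pos[of x] by (intro mult_strict_right_mono) auto
      also have "\<dots> \<le> (1 - \<epsilon>) * F ((1 + \<epsilon>) / \<mu> ^ k * x)"
        unfolding mult.assoc using elim \<epsilon> by (intro mult_left_mono) auto
      also have "\<dots> \<le> C_exceed k x" by fact
      finally show ?case using pos[of x] by (simp add: field_simps)
    qed
  next
    fix l assume l: "l > \<mu> powr (real k * \<alpha>)"
    have "((\<lambda>\<epsilon>. \<epsilon> + (((1 - \<epsilon>) / \<mu> ^ k) powr (-\<alpha>) + \<epsilon>)) \<longlongrightarrow> 0 + (((1 - 0) / \<mu> ^ k) powr (-\<alpha>) + 0)) (at_right 0)"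
      using mu by (intro tendsto_intros) auto
    then have "\<forall>\<^sub>F \<epsilon> in at_right 0. \<epsilon> + (((1 - \<epsilon>) / \<mu> ^ k) powr (-\<alpha>) + \<epsilon>) < l"
      using l lim0 by (intro order_tendstoD(2)) auto
    moreover have "\<forall>\<^sub>F \<epsilon> in at_right (0::real). \<epsilon> \<in> {0<..<1}"
      by (rule eventually_at_right_real) simp
    ultimately have "\<forall>\<^sub>F \<epsilon> in at_right 0. \<epsilon> + (((1 - \<epsilon>) / \<mu> ^ k) powr (-\<alpha>) + \<epsilon>) < l \<and> \<epsilon> \<in> {0<..<1}"
      by (rule eventually_conj)
    from eventually_happens'[OF trivial_limit_at_right_real this]
    obtain \<epsilon> :: real where \<epsilon>: "0 < \<epsilon>" "\<epsilon> < 1" "\<epsilon> + (((1 - \<epsilon>) / \<mu> ^ k) powr (-\<alpha>) + \<epsilon>) < l"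
      by auto
    have "\<forall>\<^sub>F x in at_top. F ((1 - \<epsilon>) / \<mu> ^ k * x) \<le> (((1 - \<epsilon>) / \<mu> ^ k) powr (-\<alpha>) + \<epsilon>) * F x"
      using \<epsilon> mk by (intro eventually_scaled_le) auto
    with C_exceed_upper[OF \<epsilon>(1,2,1), of k] show "\<forall>\<^sub>F x in at_top. C_exceed k x / F x < l"
    proof eventually_elim
      case (elim x)
      have "C_exceed k x \<le> (\<epsilon> + (((1 - \<epsilon>) / \<mu> ^ k) powr (-\<alpha>) + \<epsilon>)) * F x"
        using elim by (simp add: algebra_simps)
      also have "\<dots> < l * F x"
        using \<epsilon> pos[of x] by (intro mult_strict_right_mono) auto
      finally show ?case using pos[of x] by (simp add: field_simps)
    qed
  qed
qed

text \<open>The number \<open>z = y / (2 \<mu>\<^sup>k)\<close> with \<open>k = K + j\<close> and \<open>y = (1 - \<mu> powr (1/4)) * \<mu> powr (j/4) * x\<close> is the start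
  whose \<open>k\<close>-th generation has mean \<open>y / 2\<close>, where \<open>y\<close> is the threshold of \<open>C_exceed_geometric\<close>. Since
  \<open>y\<close> decreases more slowly than \<open>\<mu>\<^sup>j\<close>, this start is at least a multiple of \<open>x\<close> and grows
  geometrically, so that Potter's bound applies uniformly in \<open>K\<close> and \<open>j\<close>.\<close>

lemma F_geometric:
  obtains D x0 where "D > 0" "x0 > 0"
    "\<And>x K j. x \<ge> x0 \<Longrightarrow>
      F ((1 - \<mu> powr (1/4)) / 2 * x * \<mu> powr (- (real K + 3/4 * real j)))
        \<le> D * \<mu> powr (\<alpha> / 2 * real K + 3/8 * \<alpha> * real j) * F x"
proof -
  define b where "b = (1 - \<mu> powr (1/4)) / 2"
  have b: "b > 0" using mu_powr_less_1[of "1/4"] by (simp add: b_def)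
  have "0 \<le> \<alpha> / 2" "\<alpha> / 2 < \<alpha>" using alpha_pos by auto
  then obtain D1 x1 where D1: "D1 > 0" "x1 > 0"
    "\<And>x l. x \<ge> x1 \<Longrightarrow> l \<ge> 1 \<Longrightarrow> F (l * x) \<le> D1 * l powr (-(\<alpha>/2)) * F x"
    by (rule potter_upper, blast)
  have "\<forall>\<^sub>F x in at_top. F (b * x) \<le> 2 * b powr (-\<alpha>) * F x"
    using b by (intro eventually_scaled_le) auto
  then obtain x2 where x2: "\<And>x. x \<ge> x2 \<Longrightarrow> F (b * x) \<le> 2 * b powr (-\<alpha>) * F x"
    unfolding eventually_at_top_linorder by blast
  show thesis
  proof (rule that[of "D1 * (2 * b powr (-\<alpha>))" "max (x1 / b) x2"])
    show "D1 * (2 * b powr (-\<alpha>)) > 0" using D1(1) b by simp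
    show "max (x1 / b) x2 > 0" using D1(2) b by (simp add: less_max_iff_disj)
    fix x :: real and K j :: nat assume x: "x \<ge> max (x1 / b) x2"
    define l where "l = \<mu> powr (- (real K + 3/4 * real j))"
    have "\<mu> powr 0 \<le> l" unfolding l_def using mu by (intro powr_mono') auto
    then have l: "l \<ge> 1" using mu by simp
    have bx: "b * x \<ge> x1" using x b by (simp add: field_simps)
    have "F (b * x * l) \<le> D1 * l powr (-(\<alpha>/2)) * F (b * x)"
      using D1(3)[OF bx l] by (simp add: mult.commute)
    also have "\<dots> \<le> D1 * l powr (-(\<alpha>/2)) * (2 * b powr (-\<alpha>) * F x)"
      using D1(1) x x2[of x] by (intro mult_left_mono) auto
    also have "l powr (-(\<alpha>/2)) = \<mu> powr (\<alpha> / 2 * real K + 3/8 * \<alpha> * real j)"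
      unfolding l_def powr_powr by (rule arg_cong[where f = "\<lambda>r. \<mu> powr r"]) (simp add: field_simps)
    finally show "F ((1 - \<mu> powr (1/4)) / 2 * x * \<mu> powr (- (real K + 3/4 * real j)))
        \<le> D1 * (2 * b powr (-\<alpha>)) * \<mu> powr (\<alpha> / 2 * real K + 3/8 * \<alpha> * real j) * F x"
      by (simp add: b_def l_def mult_ac)
  qed
qed

text \<open>The weights \<open>(1 - \<mu> powr (1/4)) * \<mu> powr (j/4)\<close> add up to \<open>1\<close>; they distribute the threshold \<open>x\<close> over
  the generations \<open>K + j\<close>. Starts above \<open>z\<close> are handled by \<open>F_geometric\<close>, starts below \<open>z\<close> by Markov's
  or Chebyshev's inequality. In the second case the exponents of \<open>\<mu>\<close> add up to \<open>\<alpha>/2 * K + s * j\<close> with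
  \<open>s = (3 \<alpha> - 2) / 8\<close>; the rate \<open>1/4\<close> is slow enough to make this \<open>s\<close> positive for all \<open>\<alpha> \<ge> 1\<close>.\<close>

lemma C_exceed_geometric:
  obtains D s x0 where "D > 0" "s > 0" "x0 > 0"
    "\<And>x K j. x \<ge> x0 \<Longrightarrow>
      C_exceed (K + j) ((1 - \<mu> powr (1/4)) * \<mu> powr (1/4 * real j) * x)
        \<le> D * \<mu> powr (\<alpha> / 2 * real K + s * real j) * F x"
proof -
  define b where "b = 1 - \<mu> powr (1/4)"
  have b: "b > 0" using mu_powr_less_1[of "1/4"] by (simp add: b_def)
  obtain D1 x1 where D1: "D1 > 0" "x1 > 0" "\<And>x K j. x \<ge> x1 \<Longrightarrow>
      F (b / 2 * x * \<mu> powr (- (real K + 3/4 * real j)))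
        \<le> D1 * \<mu> powr (\<alpha> / 2 * real K + 3/8 * \<alpha> * real j) * F x"
    unfolding b_def by (rule F_geometric, blast)
  define y z where "y x j = b * \<mu> powr (1/4 * real j) * x"
    and "z x K j = b / 2 * x * \<mu> powr (- (real K + 3/4 * real j))" for x and K j :: nat
  have y_pos: "y x j > 0" if "x > 0" for x and j :: nat using that b mu by (simp add: y_def)
  have z_eq: "\<mu> ^ (K + j) * z x K j = y x j / 2" for x and K j :: nat
  proof -
    have "\<mu> ^ (K + j) * \<mu> powr (- (real K + 3/4 * real j)) = \<mu> powr (1/4 * real j)"
      unfolding powr_realpow[OF mu(1), symmetric] powr_add[symmetric]
      by (rule arg_cong[where f = "\<lambda>r. \<mu> powr r"]) simp
    then show ?thesis by (simp add: y_def z_def mult_ac)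
  qed
  have z_ge: "b / 2 * x \<le> z x K j" if "x > 0" for x and K j :: nat
  proof -
    have "\<mu> powr 0 \<le> \<mu> powr (- (real K + 3/4 * real j))" using mu by (intro powr_mono') auto
    then have "b / 2 * x * 1 \<le> z x K j" unfolding z_def using mu b that
      by (intro mult_left_mono) auto
    then show ?thesis by simp
  qed
  show thesis
  proof (cases "\<alpha> < 1")
    case True
    obtain c x0 where c: "c > 0" "x0 > 0" "\<And>z. z \<ge> x0 \<Longrightarrow> trunc_mean z \<le> c * (z * F z)"
      by (rule truncated_mean_le_tail[OF trunc_mean_le trunc_mean_double True]; blast)
    show thesis
    proof (rule that[of "(c / 2 + 1) * D1" "3/8 * \<alpha>" "max x1 (2 * x0 / b)"])
      fix x :: real and K j :: nat assume x: "x \<ge> max x1 (2 * x0 / b)"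
      have x0: "x > 0" using x D1(2) by simp
      define k where "k = K + j"
      have y: "y x j > 0" using y_pos x0 by blast
      have zz: "z x K j \<ge> x0"
      proof -
        have "x0 \<le> b / 2 * x" using x b by (simp add: field_simps)
        then show ?thesis using z_ge[OF x0, of K j] by linarith
      qed
      have "C_exceed k (y x j) \<le> \<mu> ^ k / y x j * trunc_mean (z x K j) + (0 * F 0 + F (z x K j))"
      proof (rule C_exceed_le)
        fix n
        show "gw_exceed k n (y x j) \<le> \<mu> ^ k / y x j * (real n * indicator {n. real n \<le> z x K j} n) +
           (0 * indicator {n. 0 < real n} n + indicator {n. z x K j < real n} n)"
          using gw_exceed_markov[OF y, of k n] gw_exceed_bounds(2)[of k n "y x j"] by (auto simp: indicator_def)
      qed
      also have "\<dots> \<le> \<mu> ^ k / y x j * (c * (z x K j * F (z x K j))) + F (z x K j)"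
        using c(3)[OF zz] y mu by (simp add: divide_right_mono mult_left_mono)
      also have "\<dots> = c * (\<mu> ^ k * z x K j / y x j) * F (z x K j) + F (z x K j)" by simp
      also have "\<mu> ^ k * z x K j / y x j = 1 / 2" unfolding k_def z_eq using y by simp
      also have "c * (1 / 2) * F (z x K j) + F (z x K j) = (c / 2 + 1) * F (z x K j)"
        by (simp add: algebra_simps)
      also have "\<dots> \<le> (c / 2 + 1) * (D1 * \<mu> powr (\<alpha> / 2 * real K + 3/8 * \<alpha> * real j) * F x)"
        unfolding z_def using x c(1) by (intro mult_left_mono D1(3)) auto
      finally show "C_exceed (K + j) ((1 - \<mu> powr (1/4)) * \<mu> powr (1/4 * real j) * x)
        \<le> (c / 2 + 1) * D1 * \<mu> powr (\<alpha> / 2 * real K + 3/8 * \<alpha> * real j) * F x"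
        by (simp add: y_def b_def k_def mult.assoc)
    qed (use c D1(1,2) b alpha_pos in \<open>auto simp: add_pos_pos less_max_iff_disj\<close>)
  next
    case False
    then have a1: "1 \<le> \<alpha>" by simp
    obtain c where c: "c \<ge> 0" "\<And>k n x. x > 0 \<Longrightarrow> \<mu> ^ k * real n \<le> x / 2 \<Longrightarrow> gw_exceed k n x \<le> c * \<mu> ^ k / x\<^sup>2 * real n"
      by (rule gw_exceed_chebyshev[OF a1], blast)
    obtain d x0 where d: "d > 0" "x0 > 0" "\<And>z. z \<ge> x0 \<Longrightarrow> trunc_mean z \<le> d * z powr (1 - \<alpha> / 2)"
      by (rule truncated_mean_le_powr[OF trunc_mean_le trunc_mean_double alpha_less]; blast)
    have "\<forall>\<^sub>F x in at_top. x powr (-(1 + \<alpha>/2)) \<le> 1 * F x"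
      using alpha_less by (intro powr_smallo) auto
    then obtain x2 where x2: "\<And>x. x \<ge> x2 \<Longrightarrow> x powr (-(1 + \<alpha>/2)) \<le> F x"
      unfolding eventually_at_top_linorder by auto
    define s where "s = (3 * \<alpha> - 2) / 8"
    define B where "B = c * d * (b powr (-2) * (b / 2) powr (1 - \<alpha>/2))"
    have B: "B \<ge> 0" using c(1) d(1) by (simp add: B_def)
    show thesis
    proof (rule that[of "B + D1" s "max (max x1 x2) (2 * x0 / b)"])
      fix x :: real and K j :: nat assume x: "x \<ge> max (max x1 x2) (2 * x0 / b)"
      have x0: "x > 0" using x D1(2) by simp
      define k where "k = K + j"
      have y: "y x j > 0" using y_pos x0 by blast
      have zz: "z x K j \<ge> x0"
      proof -
        have "x0 \<le> b / 2 * x" using x b by (simp add: field_simps)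
        then show ?thesis using z_ge[OF x0, of K j] by linarith
      qed
      have "C_exceed k (y x j) \<le> c * \<mu> ^ k / (y x j)\<^sup>2 * trunc_mean (z x K j) + (0 * F 0 + F (z x K j))"
      proof (rule C_exceed_le)
        fix n
        have "gw_exceed k n (y x j) \<le> c * \<mu> ^ k / (y x j)\<^sup>2 * real n" if "real n \<le> z x K j"
        proof (rule c(2)[OF y])
          have "\<mu> ^ k * real n \<le> \<mu> ^ k * z x K j" using that mu by (intro mult_left_mono) auto
          then show "\<mu> ^ k * real n \<le> y x j / 2" by (simp add: k_def z_eq)
        qed
        then show "gw_exceed k n (y x j) \<le> c * \<mu> ^ k / (y x j)\<^sup>2 * (real n * indicator {n. real n \<le> z x K j} n) +
           (0 * indicator {n. 0 < real n} n + indicator {n. z x K j < real n} n)"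
          using gw_exceed_bounds(2)[of k n "y x j"] by (auto simp: indicator_def)
      qed
      also have "\<dots> \<le> c * \<mu> ^ k / (y x j)\<^sup>2 * (d * z x K j powr (1 - \<alpha> / 2)) + F (z x K j)"
        using d(3)[OF zz] y mu c(1) by (simp add: divide_right_mono mult_left_mono)
      also have "c * \<mu> ^ k / (y x j)\<^sup>2 * (d * z x K j powr (1 - \<alpha> / 2))
         = c * d * (\<mu> powr (real K + real j) * (y x j powr (-2) * z x K j powr (1 - \<alpha> / 2)))"
      proof -
        have "y x j powr (-2) = 1 / (y x j)\<^sup>2" using y powr_neg_numeral[of "y x j" "num.Bit0 num.One"] by simp
        moreover have "\<mu> powr (real K + real j) = \<mu> ^ k"
          using powr_realpow[OF mu(1), of k] by (simp add: k_def)
        ultimately show ?thesis by simp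
      qed
      also have "y x j powr (-2) * z x K j powr (1 - \<alpha> / 2) =
         (b powr (-2) * (b / 2) powr (1 - \<alpha>/2)) * (\<mu> powr (1/4 * real j * (-2)) * \<mu> powr (- (real K + 3/4 * real j) * (1 - \<alpha>/2)))
           * (x powr (-2) * x powr (1 - \<alpha>/2))"
        unfolding y_def z_def using x0 b mu by (simp only: powr_mult powr_powr mult_ac)
      also have "x powr (-2) * x powr (1 - \<alpha>/2) = x powr (-(1 + \<alpha>/2))"
        unfolding powr_add[symmetric] by simp
      also have "c * d * (\<mu> powr (real K + real j) *
          ((b powr (-2) * (b / 2) powr (1 - \<alpha>/2)) * (\<mu> powr (1/4 * real j * (-2)) * \<mu> powr (- (real K + 3/4 * real j) * (1 - \<alpha>/2))) * x powr (-(1 + \<alpha>/2))))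
        = B * (\<mu> powr (real K + real j) * (\<mu> powr (1/4 * real j * (-2)) * \<mu> powr (- (real K + 3/4 * real j) * (1 - \<alpha>/2)))) * x powr (-(1 + \<alpha>/2))"
        unfolding B_def by (simp only: mult_ac)
      also have "\<mu> powr (real K + real j) * (\<mu> powr (1/4 * real j * (-2)) * \<mu> powr (- (real K + 3/4 * real j) * (1 - \<alpha>/2)))
         = \<mu> powr (\<alpha>/2 * real K + s * real j)"
        unfolding powr_add[symmetric]
        by (rule arg_cong[where f = "\<lambda>r. \<mu> powr r"]) (simp add: s_def field_simps)
      also have "B * \<mu> powr (\<alpha>/2 * real K + s * real j) * x powr (-(1 + \<alpha>/2)) \<le>
          B * \<mu> powr (\<alpha>/2 * real K + s * real j) * F x"
        using x x2[of x] B by (intro mult_left_mono) auto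
      also have "F (z x K j) \<le> D1 * \<mu> powr (\<alpha> / 2 * real K + s * real j) * F x"
      proof -
        have "F (z x K j) \<le> D1 * \<mu> powr (\<alpha> / 2 * real K + 3/8 * \<alpha> * real j) * F x"
          unfolding z_def using x by (intro D1(3)) auto
        also have "\<dots> \<le> D1 * \<mu> powr (\<alpha> / 2 * real K + s * real j) * F x"
        proof (intro mult_right_mono mult_left_mono powr_mono')
          have "s \<le> 3/8 * \<alpha>" by (simp add: s_def)
          then show "\<alpha> / 2 * real K + s * real j \<le> \<alpha> / 2 * real K + 3/8 * \<alpha> * real j"
            by (intro add_left_mono mult_right_mono) auto
        qed (use mu D1(1) pos[of x] in auto)
        finally show ?thesis .
      qed
      finally show "C_exceed (K + j) ((1 - \<mu> powr (1/4)) * \<mu> powr (1/4 * real j) * x)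
        \<le> (B + D1) * \<mu> powr (\<alpha> / 2 * real K + s * real j) * F x"
        by (simp add: y_def b_def k_def algebra_simps)
    qed (use c d D1(1,2) B b a1 in \<open>auto simp: add_nonneg_pos less_max_iff_disj s_def\<close>)
  qed
qed

end

section \<open>Laws and independence of the generations of the immigrants\<close>

text \<open>Passing to probability mass functions turns conditioning on the previous generation into
  \<open>bind_pmf\<close>.\<close>

lemma pmf_of_nat_distr:
  fixes A :: "'p \<Rightarrow> nat"
  assumes "prob_space P" "A \<in> measurable P (count_space UNIV)"
  obtains p where "distr P (count_space UNIV) A = measure_pmf p"
proof -
  interpret D: prob_space "distr P (count_space UNIV) A"
    using assms by (rule prob_space.prob_space_distr)
  have "AE x in distr P (count_space UNIV) A. measure (distr P (count_space UNIV) A) {x} \<noteq> 0"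
    by (subst D.AE_support_countable) (auto intro: exI[of _ UNIV])
  then have "distr P (count_space UNIV) A \<in> {M. prob_space M \<and> sets M = UNIV \<and> (AE x in M. measure M {x} \<noteq> 0)}"
    using D.prob_space_axioms by simp
  then show thesis using that by (rule measure_pmf_cases)
qed

lemma measurable_nat_add:
  fixes f g :: "'a \<Rightarrow> nat"
  assumes f: "f \<in> measurable M (count_space UNIV)" and g: "g \<in> measurable M (count_space UNIV)"
  shows "(\<lambda>x. f x + g x) \<in> measurable M (count_space UNIV)"
  by (rule measurable_compose_countable[OF _ f, of "\<lambda>m x. m + g x"])
     (rule measurable_compose[OF g], simp)

lemma measurable_nat_sum:
  fixes f :: "nat \<Rightarrow> 'a \<Rightarrow> nat"
  assumes f: "\<And>i. f i \<in> measurable M (count_space UNIV)"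
  shows "(\<lambda>x. \<Sum>i<n. f i x) \<in> measurable M (count_space UNIV)"
proof (induction n)
  case (Suc n)
  then show ?case using measurable_nat_add[OF Suc f[of n]] by simp
qed simp

context prob_space
begin

text \<open>Splitting over the values of \<open>N\<close> leaves one fixed index at a time, so \<open>N\<close> has to be independent of each
  \<open>W n\<close> separately only. The index is the size of the previous generation, or a single summand when it is
  added to a sum of independent ones.\<close>

lemma distr_random_index:
  fixes N :: "'a \<Rightarrow> nat" and W :: "nat \<Rightarrow> 'a \<Rightarrow> nat"
  assumes N: "N \<in> measurable M (count_space UNIV)" "distr M (count_space UNIV) N = measure_pmf r"
    and W: "\<And>n. W n \<in> measurable M (count_space UNIV)"
      "\<And>n. distr M (count_space UNIV) (W n) = measure_pmf (\<kappa> n)"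
    and ind: "\<And>n S. prob {\<omega> \<in> space M. N \<omega> \<in> {n} \<and> W n \<omega> \<in> S}
       = prob {\<omega> \<in> space M. N \<omega> \<in> {n}} * prob {\<omega> \<in> space M. W n \<omega> \<in> S}"
  shows "distr M (count_space UNIV) (\<lambda>\<omega>. W (N \<omega>) \<omega>) = measure_pmf (bind_pmf r \<kappa>)"
proof (rule measure_eqI)
  have meas: "(\<lambda>\<omega>. W (N \<omega>) \<omega>) \<in> measurable M (count_space UNIV)"
    by (rule measurable_compose_countable[OF W(1) N(1)])
  have sets_W: "{\<omega> \<in> space M. W n \<omega> \<in> S} \<in> events" for n S
    using measurable_sets[OF W(1)[of n], of S] by (simp add: vimage_def Int_def conj_commute)
  have sets_N: "{\<omega> \<in> space M. N \<omega> \<in> S} \<in> events" for S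
    using measurable_sets[OF N(1), of S] by (simp add: vimage_def Int_def conj_commute)
  have pN: "emeasure M {\<omega> \<in> space M. N \<omega> \<in> S} = emeasure r S" for S
    unfolding N(2)[symmetric] using N(1) by (simp add: emeasure_distr vimage_def Int_def conj_commute)
  have pW: "emeasure M {\<omega> \<in> space M. W n \<omega> \<in> S} = emeasure (\<kappa> n) S" for n S
    unfolding W(2)[symmetric] using W(1) by (simp add: emeasure_distr vimage_def Int_def conj_commute)
  fix S assume "S \<in> sets (distr M (count_space UNIV) (\<lambda>\<omega>. W (N \<omega>) \<omega>))"
  define E where "E n = {\<omega> \<in> space M. N \<omega> \<in> {n} \<and> W n \<omega> \<in> S}" for n
  have E: "E n \<in> events" for n
  proof -
    have "E n = {\<omega> \<in> space M. N \<omega> \<in> {n}} \<inter> {\<omega> \<in> space M. W n \<omega> \<in> S}" by (auto simp: E_def)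
    then show ?thesis using sets.Int[OF sets_N[of "{n}"] sets_W[of n S]] by (simp only:)
  qed
  have "emeasure (distr M (count_space UNIV) (\<lambda>\<omega>. W (N \<omega>) \<omega>)) S = emeasure M (\<Union>n. E n)"
    using meas by (subst emeasure_distr) (auto intro!: arg_cong[where f = "emeasure M"] simp: E_def)
  also have "\<dots> = (\<Sum>n. emeasure M (E n))"
    using E by (intro suminf_emeasure[symmetric]) (auto simp: disjoint_family_on_def E_def)
  also have "\<dots> = (\<Sum>n. ennreal (pmf r n) * emeasure (\<kappa> n) S)"
  proof (intro suminf_cong)
    fix n
    have "emeasure M (E n) = emeasure M {\<omega> \<in> space M. N \<omega> \<in> {n}} * emeasure M {\<omega> \<in> space M. W n \<omega> \<in> S}"
      unfolding E_def emeasure_eq_measure ind by (simp add: ennreal_mult)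
    then show "emeasure M (E n) = ennreal (pmf r n) * emeasure (\<kappa> n) S"
      unfolding pN pW by (simp add: emeasure_pmf_single)
  qed
  also have "\<dots> = emeasure (bind_pmf r \<kappa>) S"
    by (simp add: nn_integral_measure_pmf nn_integral_count_space_nat)
  finally show "emeasure (distr M (count_space UNIV) (\<lambda>\<omega>. W (N \<omega>) \<omega>)) S = emeasure (bind_pmf r \<kappa>) S" .
qed simp

end

locale gw_immigration = prob_space M for M :: "'m measure" +
  fixes a :: "int \<Rightarrow> int \<Rightarrow> nat \<Rightarrow> 'm \<Rightarrow> nat" and b :: "int \<Rightarrow> 'm \<Rightarrow> nat" and p q :: "nat pmf"
  assumes indep: "indep_vars (\<lambda>_. count_space UNIV) (case_sum b (\<lambda>(s, u, i). a s u i)) UNIV"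
    and law_a: "\<And>s u i. distr M (count_space UNIV) (a s u i) = measure_pmf p"
    and law_b: "\<And>s. distr M (count_space UNIV) (b s) = measure_pmf q"
begin

text \<open>All driving variables as one family, so that functions of disjoint blocks of them are independent.\<close>

definition driver :: "'m \<Rightarrow> int + int \<times> int \<times> nat \<Rightarrow> nat" where
  "driver \<omega> j = case_sum b (\<lambda>(s, u, i). a s u i) j \<omega>"

definition step :: "int \<Rightarrow> int \<Rightarrow> nat \<Rightarrow> (int + int \<times> int \<times> nat \<Rightarrow> nat) \<Rightarrow> nat" where
  "step s u n y = (\<Sum>i<n. y (Inr (s, u, i)))"

text \<open>The \<open>k\<close>-th generation of the immigrants that arrive at time \<open>s\<close>, as a function of the values \<open>y\<close> of the
  driving variables.\<close>

definition generation :: "int \<Rightarrow> nat \<Rightarrow> (int + int \<times> int \<times> nat \<Rightarrow> nat) \<Rightarrow> nat" where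
  "generation s k y = compose_maps (\<lambda>u n. step s u n y) s k (y (Inl s))"

text \<open>A set of indices that contains all that \<open>generation s k\<close> reads. Two properties count: \<open>s\<close> is the only
  superscript, so that different \<open>s\<close> have disjoint sets, and \<open>s + k + 1\<close>, the subscript of the next map, does
  not occur.\<close>

definition inputs :: "int \<Rightarrow> nat \<Rightarrow> (int + int \<times> int \<times> nat) set" where
  "inputs s k = insert (Inl s) {Inr (s, u, i) | u i. u \<le> s + int k}"

lemma generation_0: "generation s 0 y = y (Inl s)"
  and generation_Suc: "generation s (Suc k) y = step s (s + int (Suc k)) (generation s k y) y"
  by (simp_all add: generation_def)

lemma C_eq_generation: "C a b t k \<omega> = generation (t - int k) k (driver \<omega>)"
  by (simp add: C_def generation_def step_def driver_def random_map_def[abs_def])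

lemma indep_driver: "indep_vars (\<lambda>_. count_space UNIV) (\<lambda>j \<omega>. driver \<omega> j) UNIV"
  using indep by (simp add: driver_def[abs_def])

lemma measurable_driver [measurable]: "(\<lambda>\<omega>. driver \<omega> j) \<in> measurable M (count_space UNIV)"
  using indep_driver unfolding indep_vars_def by auto

lemma measurable_step:
  assumes "\<And>i. Inr (s, u, i) \<in> J"
  shows "step s u n \<in> measurable (Pi\<^sub>M J (\<lambda>_. count_space UNIV)) (count_space UNIV)"
  unfolding step_def using assms by (intro measurable_nat_sum measurable_component_singleton)

lemma measurable_generation:
  assumes "inputs s k \<subseteq> J"
  shows "generation s k \<in> measurable (Pi\<^sub>M J (\<lambda>_. count_space UNIV)) (count_space UNIV)"
  using assms
proof (induction k)
  case 0
  then show ?case unfolding generation_0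
    by (intro measurable_component_singleton) (auto simp: inputs_def)
next
  case (Suc k)
  have "inputs s k \<subseteq> inputs s (Suc k)" by (auto simp: inputs_def)
  then have "generation s k \<in> measurable (Pi\<^sub>M J (\<lambda>_. count_space UNIV)) (count_space UNIV)"
    using Suc by blast
  then show ?case unfolding generation_Suc[abs_def]
    using Suc.prems by (intro measurable_compose_countable[OF measurable_step]) (auto simp: inputs_def)
qed

lemma step_restrict:
  assumes "\<And>i. Inr (s, u, i) \<in> J"
  shows "step s u n (restrict y J) = step s u n y"
  using assms by (simp add: step_def)

lemma generation_restrict:
  assumes "inputs s k \<subseteq> J"
  shows "generation s k (restrict y J) = generation s k y"
  using assms
proof (induction k)
  case 0
  then show ?case by (simp add: generation_0 inputs_def)
next
  case (Suc k)
  have "inputs s k \<subseteq> inputs s (Suc k)" by (auto simp: inputs_def)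
  then have "generation s k (restrict y J) = generation s k y" using Suc by blast
  moreover have "Inr (s, s + int (Suc k), i) \<in> J" for i using Suc.prems by (auto simp: inputs_def)
  ultimately show ?case by (simp only: generation_Suc step_restrict)
qed

lemma measurable_restrict_driver: "(\<lambda>\<omega>. restrict (driver \<omega>) J) \<in> measurable M (Pi\<^sub>M J (\<lambda>_. count_space UNIV))"
  by (intro measurable_restrict measurable_driver)

lemma measurable_generation_driver [measurable]: "(\<lambda>\<omega>. generation s k (driver \<omega>)) \<in> measurable M (count_space UNIV)"
  using measurable_compose[OF measurable_restrict_driver measurable_generation[OF subset_UNIV], of s k]
  by (simp only: restrict_UNIV)

lemma measurable_step_driver [measurable]: "(\<lambda>\<omega>. step s u n (driver \<omega>)) \<in> measurable M (count_space UNIV)"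
  unfolding step_def by (intro measurable_nat_sum measurable_driver)

lemma prob_disjoint_inputs:
  assumes f: "f \<in> measurable (Pi\<^sub>M I (\<lambda>_. count_space UNIV)) (count_space (UNIV :: nat set))"
    and g: "g \<in> measurable (Pi\<^sub>M J (\<lambda>_. count_space UNIV)) (count_space (UNIV :: nat set))"
    and IJ: "I \<inter> J = {}"
    and fI: "\<And>y. f (restrict y I) = f y" and gJ: "\<And>y. g (restrict y J) = g y"
  shows "prob {\<omega> \<in> space M. f (driver \<omega>) \<in> S \<and> g (driver \<omega>) \<in> S'}
    = prob {\<omega> \<in> space M. f (driver \<omega>) \<in> S} * prob {\<omega> \<in> space M. g (driver \<omega>) \<in> S'}"
proof -
  have "indep_var (count_space UNIV) (f \<circ> (\<lambda>\<omega>. restrict (driver \<omega>) I)) (count_space UNIV) (g \<circ> (\<lambda>\<omega>. restrict (driver \<omega>) J))"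
    using indep_var_restrict[OF indep_driver IJ] f g by (intro indep_var_compose) auto
  then have "indep_var (count_space UNIV) (\<lambda>\<omega>. f (driver \<omega>)) (count_space UNIV) (\<lambda>\<omega>. g (driver \<omega>))"
    by (simp add: comp_def fI gJ)
  then show ?thesis by (rule prob_indep_random_variable) auto
qed

lemma distr_step: "distr M (count_space UNIV) (\<lambda>\<omega>. step s u n (driver \<omega>)) = measure_pmf (iid_sum_pmf p n)"
proof (induction n)
  case 0
  have "distr M (count_space UNIV) (\<lambda>\<omega>. 0 :: nat) = measure_pmf (return_pmf 0)"
    by (rule measure_eqI) (auto simp: emeasure_distr emeasure_space_1 indicator_def)
  then show ?case by (simp add: step_def)
next
  case (Suc n)
  have "distr M (count_space UNIV) (\<lambda>\<omega>. driver \<omega> (Inr (s, u, n)) + step s u n (driver \<omega>))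
     = measure_pmf (bind_pmf p (\<lambda>x. map_pmf ((+) x) (iid_sum_pmf p n)))"
  proof (rule distr_random_index[of "\<lambda>\<omega>. driver \<omega> (Inr (s, u, n))" _ "\<lambda>x \<omega>. x + step s u n (driver \<omega>)"])
    show "distr M (count_space UNIV) (\<lambda>\<omega>. driver \<omega> (Inr (s, u, n))) = measure_pmf p"
      by (simp add: driver_def law_a)
    show m: "(\<lambda>\<omega>. x + step s u n (driver \<omega>)) \<in> measurable M (count_space UNIV)" for x
      by (rule measurable_compose[OF measurable_step_driver]) simp
    show "distr M (count_space UNIV) (\<lambda>\<omega>. x + step s u n (driver \<omega>)) = measure_pmf (map_pmf ((+) x) (iid_sum_pmf p n))" for x
      unfolding map_pmf_rep_eq Suc[symmetric]
      by (subst distr_distr) (auto simp: comp_def)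
    fix m S
    let ?J = "range (\<lambda>i. Inr (s, u, i)) - {Inr (s, u, n)} :: (int + int \<times> int \<times> nat) set"
    have J: "Inr (s, u, i) \<in> ?J" if "i < n" for i using that by auto
    show "prob {\<omega> \<in> space M. driver \<omega> (Inr (s, u, n)) \<in> {m} \<and> m + step s u n (driver \<omega>) \<in> S} =
      prob {\<omega> \<in> space M. driver \<omega> (Inr (s, u, n)) \<in> {m}} * prob {\<omega> \<in> space M. m + step s u n (driver \<omega>) \<in> S}"
    proof (rule prob_disjoint_inputs[of "\<lambda>y. y (Inr (s, u, n))" "{Inr (s, u, n)}" "\<lambda>y. m + step s u n y" ?J])
      show "(\<lambda>y. y (Inr (s, u, n))) \<in> measurable (Pi\<^sub>M {Inr (s, u, n)} (\<lambda>_. count_space UNIV)) (count_space UNIV)"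
        by (rule measurable_component_singleton) simp
      \<comment> \<open>\<open>measurable_nat_sum\<close> asks for every term, but the term \<open>i = n\<close> reads an index outside \<open>?J\<close>; so terms out of range become \<open>0\<close>.\<close>
      have "(\<lambda>y. \<Sum>i<n. if i < n then y (Inr (s, u, i)) else 0) \<in> measurable (Pi\<^sub>M ?J (\<lambda>_. count_space UNIV)) (count_space (UNIV :: nat set))"
      proof (rule measurable_nat_sum)
        show "(\<lambda>y. if i < n then y (Inr (s, u, i)) else 0) \<in> measurable (Pi\<^sub>M ?J (\<lambda>_. count_space UNIV)) (count_space (UNIV :: nat set))" for i
          using J[of i] by (cases "i < n") (simp_all add: measurable_component_singleton)
      qed
      then have "step s u n \<in> measurable (Pi\<^sub>M ?J (\<lambda>_. count_space UNIV)) (count_space UNIV)"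
        by (simp add: step_def[abs_def] cong: sum.cong)
      then show "(\<lambda>y. m + step s u n y) \<in> measurable (Pi\<^sub>M ?J (\<lambda>_. count_space UNIV)) (count_space UNIV)"
        by (rule measurable_compose) simp
    qed (use J in \<open>auto simp: step_def intro!: sum.cong\<close>)
  qed (rule measurable_driver)
  then show ?case by (simp add: step_def add.commute)
qed

lemma distr_generation: "distr M (count_space UNIV) (\<lambda>\<omega>. generation s k (driver \<omega>)) = measure_pmf (bind_pmf q (gw_pmf p k))"
proof (induction k)
  case 0
  then show ?case by (simp add: generation_0 driver_def law_b bind_return_pmf')
next
  case (Suc k)
  have "distr M (count_space UNIV) (\<lambda>\<omega>. step s (s + int (Suc k)) (generation s k (driver \<omega>)) (driver \<omega>))
     = measure_pmf (bind_pmf (bind_pmf q (gw_pmf p k)) (iid_sum_pmf p))"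
  proof (rule distr_random_index[of "\<lambda>\<omega>. generation s k (driver \<omega>)" _ "\<lambda>n \<omega>. step s (s + int (Suc k)) n (driver \<omega>)"])
    fix n S
    define u where "u = s + int (Suc k)"
    define J :: "(int + int \<times> int \<times> nat) set" where "J = range (\<lambda>i. Inr (s, u, i))"
    have J: "Inr (s, u, i) \<in> J" for i by (simp add: J_def)
    have disj: "inputs s k \<inter> J = {}" by (auto simp: inputs_def J_def u_def)
    show "prob {\<omega> \<in> space M. generation s k (driver \<omega>) \<in> {n} \<and> step s (s + int (Suc k)) n (driver \<omega>) \<in> S} =
      prob {\<omega> \<in> space M. generation s k (driver \<omega>) \<in> {n}} * prob {\<omega> \<in> space M. step s (s + int (Suc k)) n (driver \<omega>) \<in> S}"
      unfolding u_def[symmetric]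
      by (rule prob_disjoint_inputs[where f = "generation s k" and g = "step s u n" and I = "inputs s k" and J = J])
         (rule measurable_generation[OF order_refl] measurable_step[OF J] disj generation_restrict[OF order_refl] step_restrict[OF J])+
  qed (auto intro: measurable_generation_driver measurable_step_driver Suc distr_step)
  then show ?case by (simp add: generation_Suc bind_assoc_pmf del: of_nat_Suc)
qed

lemma measurable_C [measurable]: "C a b t k \<in> measurable M (count_space UNIV)"
  unfolding C_eq_generation[abs_def] by (rule measurable_generation_driver)

lemma prob_C: "prob {\<omega> \<in> space M. C a b t k \<omega> \<in> S} = measure_pmf.prob (bind_pmf q (gw_pmf p k)) S"
  unfolding C_eq_generation distr_generation[of "t - int k", symmetric]
  by (subst measure_distr) (auto intro!: arg_cong[where f = prob] measurable_generation_driver)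

lemma prob_C_pair:
  assumes "j \<noteq> k"
  shows "prob {\<omega> \<in> space M. C a b t j \<omega> \<in> S \<and> C a b t k \<omega> \<in> S'}
    = prob {\<omega> \<in> space M. C a b t j \<omega> \<in> S} * prob {\<omega> \<in> space M. C a b t k \<omega> \<in> S'}"
  unfolding C_eq_generation
proof (rule prob_disjoint_inputs[where f = "generation (t - int j) j" and g = "generation (t - int k) k"
      and I = "inputs (t - int j) j" and J = "inputs (t - int k) k"])
  show "inputs (t - int j) j \<inter> inputs (t - int k) k = {}" using assms by (auto simp: inputs_def)
qed (rule measurable_generation[OF order_refl] generation_restrict[OF order_refl])+

end

section \<open>One big jump\<close>

text \<open>Deterministic form of the one-big-jump principle: if at most one term exceeds \<open>h\<close>, the others add up to at
  most \<open>K h\<close>.\<close>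

lemma sum_le_of_single_large:
  fixes c :: "nat \<Rightarrow> real"
  assumes h: "0 \<le> h" "0 \<le> m"
    and big: "\<And>k. k < K \<Longrightarrow> c k \<le> m"
    and two: "\<And>i j. i < K \<Longrightarrow> j < i \<Longrightarrow> c i \<le> h \<or> c j \<le> h"
  shows "(\<Sum>k<K. c k) \<le> m + real K * h"
proof (cases "\<exists>i<K. h < c i")
  case True
  then obtain i where i: "i < K" "h < c i" by blast
  have small: "c j \<le> h" if "j < K" "j \<noteq> i" for j
    using two[of i j] two[of j i] i that by (cases "j < i") auto
  have "(\<Sum>k<K. c k) = c i + (\<Sum>k\<in>{..<K} - {i}. c k)"
    using i by (simp add: sum.remove)
  also have "\<dots> \<le> m + (\<Sum>k\<in>{..<K} - {i}. h)"
    using big i small by (intro add_mono sum_mono) auto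
  also have "(\<Sum>k\<in>{..<K} - {i}. h) \<le> (\<Sum>k<K. h)"
    using h by (intro sum_mono2) auto
  finally show ?thesis by simp
next
  case False
  then have "c k \<le> h" if "k < K" for k using that by force
  then have "(\<Sum>k<K. c k) \<le> (\<Sum>k<K. h)" by (intro sum_mono) auto
  then show ?thesis using h by simp
qed

text \<open>The threshold \<open>e / (K + 1) * x\<close> makes the small terms among the first \<open>K\<close> add up to at most \<open>e x\<close>;
  \<open>K + 1\<close> in place of \<open>K\<close> keeps it positive for \<open>K = 0\<close>.\<close>

lemma suminf_le_of_single_large:
  fixes c :: "nat \<Rightarrow> nat" and w :: "nat \<Rightarrow> real"
  assumes x: "0 < x" and e: "0 < e" "e < 1/2"
    and w: "w sums 1" "\<And>j. 0 \<le> w j"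
    and big: "\<And>k. k < K \<Longrightarrow> real (c k) \<le> (1 - 2 * e) * x"
    and two: "\<And>i j. i < K \<Longrightarrow> j < i \<Longrightarrow> real (c i) \<le> e / (real K + 1) * x \<or> real (c j) \<le> e / (real K + 1) * x"
    and tail: "\<And>j. real (c (K + j)) \<le> w j * (e * x)"
  shows "(\<Sum>k. of_nat (c k) :: ennreal) \<le> ennreal x"
proof -
  have "(\<Sum>k<K. real (c k)) \<le> (1 - 2 * e) * x + real K * (e / (real K + 1) * x)"
    using big two x e by (intro sum_le_of_single_large) auto
  also have "real K * (e / (real K + 1) * x) \<le> e * x"
    using x e by (simp add: field_simps)
  finally have first: "(\<Sum>k<K. real (c k)) \<le> (1 - e) * x" by (simp add: algebra_simps)
  have "(\<Sum>k. of_nat (c k) :: ennreal) = (\<Sum>j. of_nat (c (j + K))) + (\<Sum>k<K. of_nat (c k))"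
    by (rule suminf_offset) simp
  also have "\<dots> \<le> (\<Sum>j. ennreal (w j * (e * x))) + ennreal ((1 - e) * x)"
  proof (rule add_mono)
    show "(\<Sum>j. of_nat (c (j + K)) :: ennreal) \<le> (\<Sum>j. ennreal (w j * (e * x)))"
      using tail by (intro suminf_le) (auto simp: ennreal_of_nat_eq_real_of_nat add.commute intro!: ennreal_leI)
    have "(\<Sum>k<K. of_nat (c k) :: ennreal) = ennreal (\<Sum>k<K. real (c k))"
      by (simp add: ennreal_of_nat_eq_real_of_nat sum_ennreal)
    then show "(\<Sum>k<K. of_nat (c k) :: ennreal) \<le> ennreal ((1 - e) * x)"
      using first by (simp add: ennreal_leI)
  qed
  also have "(\<Sum>j. ennreal (w j * (e * x))) = ennreal (1 * (e * x))"
    using w x e by (intro suminf_ennreal_eq sums_mult2) auto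
  also have "ennreal (1 * (e * x)) + ennreal ((1 - e) * x) = ennreal x"
    using x e by (simp add: algebra_simps flip: ennreal_plus)
  finally show ?thesis .
qed

text \<open>Adding the event \<open>E K\<close> to the union of the previous ones gains \<open>prob (E K)\<close> up to the overlap, and the
  overlap is at most the sum of the pairwise intersections.\<close>

lemma (in prob_space) bonferroni_lower:
  fixes E :: "nat \<Rightarrow> 'a set"
  assumes E: "\<And>k. E k \<in> events"
  shows "(\<Sum>k<K. prob (E k)) - (\<Sum>i<K. \<Sum>j<i. prob (E i \<inter> E j)) \<le> prob (\<Union>k<K. E k)"
proof (induction K)
  case (Suc K)
  have U: "(\<Union>k<K. E k) \<in> events" using E by auto
  have "prob (\<Union>k<Suc K. E k) = prob (E K \<union> (\<Union>k<K. E k))" by (simp add: lessThan_Suc)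
  also have "\<dots> = prob (E K) + prob (\<Union>k<K. E k) - prob (E K \<inter> (\<Union>k<K. E k))"
    using E U by (intro measure_Un3) (auto simp: fmeasurable_eq_sets)
  finally have 1: "prob (\<Union>k<Suc K. E k) = prob (E K) + prob (\<Union>k<K. E k) - prob (E K \<inter> (\<Union>k<K. E k))" .
  have "prob (E K \<inter> (\<Union>k<K. E k)) = prob (\<Union>j\<in>{..<K}. E K \<inter> E j)" by simp
  also have "\<dots> \<le> (\<Sum>j<K. prob (E K \<inter> E j))"
    using E by (intro measure_UNION_le) auto
  finally show ?case using 1 Suc by simp
qed simp

locale gw_immigration_tail = gw_immigration M a b p q + gw_tail F \<alpha> p q \<mu>
  for M :: "'m measure" and a :: "int \<Rightarrow> int \<Rightarrow> nat \<Rightarrow> 'm \<Rightarrow> nat" and b :: "int \<Rightarrow> 'm \<Rightarrow> nat"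
    and p q :: "nat pmf" and F :: "real \<Rightarrow> real" and \<alpha> \<mu> :: real
begin

abbreviation exceed :: "int \<Rightarrow> nat \<Rightarrow> real \<Rightarrow> 'm set" where
  "exceed t k x \<equiv> {\<omega> \<in> space M. x < real (C a b t k \<omega>)}"

lemma exceed_sets [measurable]: "exceed t k x \<in> events"
  by measurable

lemma prob_exceed: "prob (exceed t k x) = C_exceed k x"
  using prob_C[of t k "{y. x < real y}"] by (simp add: C_exceed_def)

lemma prob_exceed_pair:
  assumes "j \<noteq> k"
  shows "prob (exceed t j x \<inter> exceed t k x) = C_exceed j x * C_exceed k x"
proof -
  have "exceed t j x \<inter> exceed t k x = {\<omega> \<in> space M. C a b t j \<omega> \<in> {y. x < real y} \<and> C a b t k \<omega> \<in> {y. x < real y}}"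
    by auto
  then show ?thesis
    using prob_C_pair[OF assms, of t "{y. x < real y}" "{y. x < real y}"]
      prob_exceed[where t = t and k = j and x = x] prob_exceed[where t = t and k = k and x = x] by simp
qed

lemma C_exceed_scaled_asymp:
  assumes "c > 0"
  shows "((\<lambda>x. C_exceed k (c * x) / F x) \<longlongrightarrow> \<mu> powr (real k * \<alpha>) * c powr (-\<alpha>)) at_top"
proof -
  have "filterlim (\<lambda>x. c * x) at_top at_top"
    using assms by (intro filterlim_tendsto_pos_mult_at_top[OF tendsto_const]) (auto simp: filterlim_ident)
  then have "((\<lambda>x. C_exceed k (c * x) / F (c * x)) \<longlongrightarrow> \<mu> powr (real k * \<alpha>)) at_top"
    using filterlim_compose[OF C_exceed_asymp] by blast
  from tendsto_mult[OF this ratio[OF assms]] show ?thesis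
    using pos by (simp add: less_imp_neq[OF pos, symmetric])
qed

lemma C_exceed_pair_negligible:
  assumes "c > 0"
  shows "((\<lambda>x. C_exceed i (c * x) * C_exceed j (c * x) / F x) \<longlongrightarrow> 0) at_top"
proof -
  have "((\<lambda>x. (C_exceed i (c * x) / F x) * (C_exceed j (c * x) / F x) * F x) \<longlongrightarrow>
      (\<mu> powr (real i * \<alpha>) * c powr (-\<alpha>)) * (\<mu> powr (real j * \<alpha>) * c powr (-\<alpha>)) * 0) at_top"
    by (intro tendsto_mult C_exceed_scaled_asymp assms tendsto_0)
  then show ?thesis by (simp add: less_imp_neq[OF pos, symmetric])
qed

text \<open>By pairwise independence, a bound for the probability that two of the first \<open>K\<close> generations exceed \<open>x\<close>.\<close>

definition pairs :: "nat \<Rightarrow> real \<Rightarrow> real" where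
  "pairs K x = (\<Sum>i<K. \<Sum>j<i. C_exceed i x * C_exceed j x)"

text \<open>Each product is of order \<open>F x\<^sup>2\<close>, and \<open>F x\<close> tends to \<open>0\<close>.\<close>

lemma pairs_negligible:
  assumes "c > 0"
  shows "((\<lambda>x. pairs K (c * x) / F x) \<longlongrightarrow> 0) at_top"
proof -
  have "((\<lambda>x. \<Sum>i<K. \<Sum>j<i. C_exceed i (c * x) * C_exceed j (c * x) / F x) \<longlongrightarrow> (\<Sum>i<K. \<Sum>j<i. 0)) at_top"
    by (intro tendsto_sum C_exceed_pair_negligible assms)
  then show ?thesis by (simp add: pairs_def sum_divide_distrib)
qed

definition progeny :: "int \<Rightarrow> 'm \<Rightarrow> ennreal" where
  "progeny t \<omega> = (\<Sum>k. of_nat (C a b t k \<omega>))"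

definition largest :: "int \<Rightarrow> 'm \<Rightarrow> ennreal" where
  "largest t \<omega> = (SUP k. of_nat (C a b t k \<omega>))"

lemma measurable_progeny [measurable]: "progeny t \<in> borel_measurable M"
  unfolding progeny_def[abs_def] by measurable

lemma measurable_largest [measurable]: "largest t \<in> borel_measurable M"
  unfolding largest_def[abs_def] by measurable

lemma less_largest_iff: "0 \<le> x \<Longrightarrow> ennreal x < largest t \<omega> \<longleftrightarrow> (\<exists>k. x < real (C a b t k \<omega>))"
  by (auto simp: largest_def less_SUP_iff ennreal_of_nat_eq_real_of_nat ennreal_less_iff)

lemma largest_le_progeny: "largest t \<omega> \<le> progeny t \<omega>"
  unfolding largest_def progeny_def
proof (intro SUP_least)
  fix k
  have "(\<Sum>i\<in>{k}. of_nat (C a b t i \<omega>) :: ennreal) \<le> (\<Sum>i. of_nat (C a b t i \<omega>))"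
    by (intro sum_le_suminf) auto
  then show "of_nat (C a b t k \<omega>) \<le> (\<Sum>k. of_nat (C a b t k \<omega>) :: ennreal)" by simp
qed

lemma largest_lower:
  assumes "0 \<le> x"
  shows "(\<Sum>k<K. C_exceed k x) - pairs K x \<le> prob {\<omega> \<in> space M. ennreal x < largest t \<omega>}"
proof -
  have "(\<Sum>k<K. C_exceed k x) - pairs K x
      = (\<Sum>k<K. prob (exceed t k x)) - (\<Sum>i<K. \<Sum>j<i. prob (exceed t i x \<inter> exceed t j x))"
    by (simp add: prob_exceed prob_exceed_pair pairs_def)
  also have "\<dots> \<le> prob (\<Union>k<K. exceed t k x)" by (intro bonferroni_lower exceed_sets)
  also have "\<dots> \<le> prob {\<omega> \<in> space M. ennreal x < largest t \<omega>}"
    using assms by (intro finite_measure_mono) (auto simp: less_largest_iff)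
  finally show ?thesis .
qed

lemma weights_sums: "(\<lambda>j. (1 - \<mu> powr (1/4)) * \<mu> powr (1/4 * real j)) sums 1"
proof -
  have less: "\<mu> powr (1/4) < 1" by (rule mu_powr_less_1) simp
  have "(\<lambda>j. (1 - \<mu> powr (1/4)) * (\<mu> powr (1/4)) ^ j) sums ((1 - \<mu> powr (1/4)) * (1 / (1 - \<mu> powr (1/4))))"
    using less by (intro sums_mult geometric_sums) simp
  moreover have "(\<mu> powr (1/4)) ^ j = \<mu> powr (1/4 * real j)" for j
    using mu by (simp add: powr_power)
  ultimately show ?thesis using less by simp
qed

text \<open>The budget \<open>x\<close> is split into \<open>(1 - 2 e) x\<close> for the largest of the first \<open>K\<close> terms, \<open>e x\<close> for the other
  ones among these, and \<open>e x\<close> for all later terms, distributed over them by the weights of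
  \<open>C_exceed_geometric\<close>. If the sum exceeds \<open>x\<close>, one of the parts exceeds its budget.\<close>

lemma progeny_upper:
  obtains D x0 where "D > 0" "x0 > 0"
    "\<And>e K x. 0 < e \<Longrightarrow> e < 1/2 \<Longrightarrow> x \<ge> x0 / e \<Longrightarrow>
      prob {\<omega> \<in> space M. ennreal x < progeny t \<omega>}
        \<le> (\<Sum>k<K. C_exceed k ((1 - 2 * e) * x)) + pairs K (e / (real K + 1) * x) + D * \<mu> powr (\<alpha> / 2 * real K) * F (e * x)"
proof -
  define w where "w j = (1 - \<mu> powr (1/4)) * \<mu> powr (1/4 * real j)" for j :: nat
  have w: "w sums 1" unfolding w_def by (rule weights_sums)
  have w_nonneg: "w j \<ge> 0" for j using mu_powr_less_1[of "1/4"] by (simp add: w_def)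
  obtain D s x0 where D: "D > 0" "s > 0" "x0 > 0"
    "\<And>x K j. x \<ge> x0 \<Longrightarrow> C_exceed (K + j) (w j * x) \<le> D * \<mu> powr (\<alpha> / 2 * real K + s * real j) * F x"
    unfolding w_def by (rule C_exceed_geometric, blast)
  define r where "r = \<mu> powr s"
  have r: "0 < r" "r < 1" using mu_powr_less_1[OF D(2)] mu by (simp_all add: r_def)
  show thesis
  proof (rule that[of "D / (1 - r)" x0])
    show "D / (1 - r) > 0" using D(1) r by simp
    show "x0 > 0" by fact
    fix e x :: real and K :: nat
    assume e: "0 < e" "e < 1/2" and x: "x \<ge> x0 / e"
    have ex: "e * x \<ge> x0" using x e by (simp add: field_simps)
    have x_pos: "x > 0" using x D(3) e by (smt (verit) divide_pos_pos)
    let ?h = "e / (real K + 1) * x"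
    let ?A = "\<Union>k<K. exceed t k ((1 - 2 * e) * x)"
    let ?B = "\<Union>i<K. \<Union>j<i. exceed t i ?h \<inter> exceed t j ?h"
    let ?R = "\<Union>j. exceed t (K + j) (w j * (e * x))"
    define g where "g j = D * \<mu> powr (\<alpha> / 2 * real K) * F (e * x) * r ^ j" for j :: nat
    have g: "g sums (D * \<mu> powr (\<alpha> / 2 * real K) * F (e * x) * (1 / (1 - r)))"
      unfolding g_def using r by (intro sums_mult geometric_sums) simp
    have Tg: "C_exceed (K + j) (w j * (e * x)) \<le> g j" for j
    proof -
      have "\<mu> powr (s * real j) = r ^ j" using mu by (simp add: r_def powr_power mult.commute)
      then show ?thesis using D(4)[OF ex, of K j] by (simp add: g_def powr_add mult_ac)
    qed
    have C_exceed_nonneg: "C_exceed k y \<ge> 0" for k y by (simp add: C_exceed_def)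
    have sum_T: "summable (\<lambda>j. C_exceed (K + j) (w j * (e * x)))"
      using Tg C_exceed_nonneg g by (intro summable_comparison_test'[OF sums_summable[OF g], of 0]) auto
    have cover: "{\<omega> \<in> space M. ennreal x < progeny t \<omega>} \<subseteq> ?A \<union> ?B \<union> ?R"
    proof (rule subsetI, rule ccontr)
      fix \<omega> assume \<omega>: "\<omega> \<in> {\<omega> \<in> space M. ennreal x < progeny t \<omega>}" and not: "\<omega> \<notin> ?A \<union> ?B \<union> ?R"
      have "progeny t \<omega> \<le> ennreal x"
        unfolding progeny_def
      proof (rule suminf_le_of_single_large[OF x_pos e w w_nonneg])
        show "real (C a b t k \<omega>) \<le> (1 - 2 * e) * x" if "k < K" for k
          using \<omega> not that by (auto simp: not_less)
        show "real (C a b t i \<omega>) \<le> ?h \<or> real (C a b t j \<omega>) \<le> ?h" if "i < K" "j < i" for i j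
          using \<omega> not that by (auto simp: not_less)
        show "real (C a b t (K + j) \<omega>) \<le> w j * (e * x)" for j
          using \<omega> not by (auto simp: not_less)
      qed
      then show False using \<omega> by auto
    qed
    have "prob {\<omega> \<in> space M. ennreal x < progeny t \<omega>} \<le> prob (?A \<union> ?B \<union> ?R)"
      using cover by (intro finite_measure_mono) auto
    also have "\<dots> \<le> prob (?A \<union> ?B) + prob ?R"
      by (intro measure_Un_le) auto
    also have "prob (?A \<union> ?B) \<le> prob ?A + prob ?B"
      by (intro measure_Un_le) auto
    also have "prob ?A \<le> (\<Sum>k<K. C_exceed k ((1 - 2 * e) * x))"
      using measure_UNION_le[of "{..<K}" "\<lambda>k. exceed t k ((1 - 2 * e) * x)" M] by (simp add: prob_exceed)
    also have "prob ?B \<le> (\<Sum>i<K. prob (\<Union>j<i. exceed t i ?h \<inter> exceed t j ?h))"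
      by (intro measure_UNION_le) auto
    also have "\<dots> \<le> (\<Sum>i<K. \<Sum>j<i. prob (exceed t i ?h \<inter> exceed t j ?h))"
      by (intro sum_mono measure_UNION_le) auto
    also have "\<dots> = pairs K ?h" by (simp add: pairs_def prob_exceed_pair)
    also have "prob ?R \<le> (\<Sum>j. prob (exceed t (K + j) (w j * (e * x))))"
      using sum_T by (intro finite_measure_subadditive_countably) (auto simp: prob_exceed)
    also have "\<dots> \<le> suminf g"
      unfolding prob_exceed using Tg sum_T sums_summable[OF g] by (intro suminf_le) auto
    also have "suminf g = D / (1 - r) * \<mu> powr (\<alpha> / 2 * real K) * F (e * x)"
      using sums_unique[OF g] by simp
    finally show "prob {\<omega> \<in> space M. ennreal x < progeny t \<omega>}
        \<le> (\<Sum>k<K. C_exceed k ((1 - 2 * e) * x)) + pairs K ?h + D / (1 - r) * \<mu> powr (\<alpha> / 2 * real K) * F (e * x)"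
      by simp
  qed
qed

lemma series_summable: "summable (\<lambda>k. \<mu> powr (real k * \<alpha>))"
proof -
  have "\<mu> powr \<alpha> < 1" using mu_powr_less_1 alpha_pos by simp
  then have "summable (\<lambda>k. (\<mu> powr \<alpha>) ^ k)" by (intro summable_geometric) simp
  then show ?thesis using mu by (simp add: powr_power mult.commute)
qed

lemma eventually_largest_gt:
  assumes l: "l < (\<Sum>k. \<mu> powr (real k * \<alpha>))"
  shows "\<forall>\<^sub>F x in at_top. l < prob {\<omega> \<in> space M. ennreal x < largest t \<omega>} / F x"
proof -
  have "\<forall>\<^sub>F K in sequentially. l < (\<Sum>k<K. \<mu> powr (real k * \<alpha>))"
    using order_tendstoD(1)[OF summable_LIMSEQ[OF series_summable] l] .
  then obtain K where K: "l < (\<Sum>k<K. \<mu> powr (real k * \<alpha>))"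
    by (meson eventually_sequentially order_refl)
  have "((\<lambda>x. (\<Sum>k<K. C_exceed k x / F x) - pairs K (1 * x) / F x) \<longlongrightarrow> (\<Sum>k<K. \<mu> powr (real k * \<alpha>)) - 0) at_top"
    by (intro tendsto_diff tendsto_sum C_exceed_asymp pairs_negligible) simp
  then have "\<forall>\<^sub>F x in at_top. l < (\<Sum>k<K. C_exceed k x / F x) - pairs K x / F x"
    using K by (intro order_tendstoD(1)) auto
  then show ?thesis using eventually_ge_at_top[of 0]
  proof eventually_elim
    case (elim x)
    have "(\<Sum>k<K. C_exceed k x / F x) - pairs K x / F x = ((\<Sum>k<K. C_exceed k x) - pairs K x) / F x"
      by (simp add: sum_divide_distrib diff_divide_distrib)
    also have "\<dots> \<le> prob {\<omega> \<in> space M. ennreal x < largest t \<omega>} / F x"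
      using elim less_imp_le[OF pos] by (intro divide_right_mono largest_lower) auto
    finally show ?case using elim by simp
  qed
qed

text \<open>The order of choice is: \<open>e\<close> so small that the factor \<open>(1 - 2 e) powr (-\<alpha>)\<close> of the main term is close to
  \<open>1\<close>; then \<open>K\<close>, depending on \<open>e\<close>, so large that the later generations are negligible; finally \<open>x\<close>.\<close>

lemma eventually_progeny_less:
  assumes l: "(\<Sum>k. \<mu> powr (real k * \<alpha>)) < l"
  shows "\<forall>\<^sub>F x in at_top. prob {\<omega> \<in> space M. ennreal x < progeny t \<omega>} / F x < l"
proof -
  define S where "S = (\<Sum>k. \<mu> powr (real k * \<alpha>))"
  define d where "d = (l - S) / 2"
  have d: "d > 0" "S + d + d = l" using l by (simp_all add: d_def S_def field_simps)
  have "((\<lambda>e. S * (1 - 2 * e) powr (-\<alpha>)) \<longlongrightarrow> S * (1 - 2 * 0) powr (-\<alpha>)) (at_right 0)"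
    by (intro tendsto_intros) auto
  then have "\<forall>\<^sub>F e in at_right 0. S * (1 - 2 * e) powr (-\<alpha>) < S + d"
    using d by (intro order_tendstoD(2)) auto
  moreover have "\<forall>\<^sub>F e in at_right (0::real). e \<in> {0<..<1/2}"
    by (rule eventually_at_right_real) simp
  ultimately have "\<forall>\<^sub>F e in at_right 0. S * (1 - 2 * e) powr (-\<alpha>) < S + d \<and> e \<in> {0<..<1/2}"
    by (rule eventually_conj)
  from eventually_happens'[OF trivial_limit_at_right_real this]
  obtain e :: real where e: "0 < e" "e < 1/2" "S * (1 - 2 * e) powr (-\<alpha>) < S + d"
    by auto
  obtain D x0 where D: "D > 0" "x0 > 0"
    "\<And>e K x. 0 < e \<Longrightarrow> e < 1/2 \<Longrightarrow> x \<ge> x0 / e \<Longrightarrow>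
      prob {\<omega> \<in> space M. ennreal x < progeny t \<omega>}
        \<le> (\<Sum>k<K. C_exceed k ((1 - 2 * e) * x)) + pairs K (e / (real K + 1) * x) + D * \<mu> powr (\<alpha> / 2 * real K) * F (e * x)"
    by (rule progeny_upper[of t], blast)
  have "\<mu> powr (\<alpha>/2) < 1" using mu_powr_less_1[of "\<alpha>/2"] alpha_pos by simp
  then have "(\<lambda>K. D * (\<mu> powr (\<alpha> / 2)) ^ K * (2 * e powr (-\<alpha>))) \<longlonglongrightarrow> D * 0 * (2 * e powr (-\<alpha>))"
    by (intro tendsto_intros LIMSEQ_power_zero) auto
  moreover have "(\<mu> powr (\<alpha> / 2)) ^ K = \<mu> powr (\<alpha> / 2 * real K)" for K
    using mu by (simp add: powr_power mult.commute)
  ultimately have "\<forall>\<^sub>F K in sequentially. D * \<mu> powr (\<alpha> / 2 * real K) * (2 * e powr (-\<alpha>)) < d"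
    using d(1) by (intro order_tendstoD(2)) auto
  then obtain K where K: "D * \<mu> powr (\<alpha> / 2 * real K) * (2 * e powr (-\<alpha>)) < d"
    by (meson eventually_sequentially order_refl)
  have "((\<lambda>x. (\<Sum>k<K. C_exceed k ((1 - 2 * e) * x) / F x) + pairs K (e / (real K + 1) * x) / F x)
     \<longlongrightarrow> (\<Sum>k<K. \<mu> powr (real k * \<alpha>) * (1 - 2 * e) powr (-\<alpha>)) + 0) at_top"
    using e by (intro tendsto_add tendsto_sum C_exceed_scaled_asymp pairs_negligible) auto
  moreover have "(\<Sum>k<K. \<mu> powr (real k * \<alpha>) * (1 - 2 * e) powr (-\<alpha>)) + 0 < S + d"
  proof -
    have "(\<Sum>k<K. \<mu> powr (real k * \<alpha>)) \<le> S"
      unfolding S_def by (intro sum_le_suminf series_summable) auto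
    then have "(\<Sum>k<K. \<mu> powr (real k * \<alpha>)) * (1 - 2 * e) powr (-\<alpha>) \<le> S * (1 - 2 * e) powr (-\<alpha>)"
      by (intro mult_right_mono) auto
    then show ?thesis using e(3) by (simp add: sum_distrib_right)
  qed
  ultimately have "\<forall>\<^sub>F x in at_top. (\<Sum>k<K. C_exceed k ((1 - 2 * e) * x) / F x) + pairs K (e / (real K + 1) * x) / F x < S + d"
    by (rule order_tendstoD(2))
  moreover have "\<forall>\<^sub>F x in at_top. F (e * x) \<le> 2 * e powr (-\<alpha>) * F x"
    using e by (intro eventually_scaled_le) auto
  ultimately show ?thesis using eventually_ge_at_top[of "x0 / e"]
  proof eventually_elim
    case (elim x)
    have "prob {\<omega> \<in> space M. ennreal x < progeny t \<omega>} / F x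
       \<le> ((\<Sum>k<K. C_exceed k ((1 - 2 * e) * x)) + pairs K (e / (real K + 1) * x) + D * \<mu> powr (\<alpha> / 2 * real K) * F (e * x)) / F x"
      using elim e less_imp_le[OF pos] by (intro divide_right_mono D(3)) auto
    also have "\<dots> = (\<Sum>k<K. C_exceed k ((1 - 2 * e) * x) / F x) + pairs K (e / (real K + 1) * x) / F x
        + D * \<mu> powr (\<alpha> / 2 * real K) * (F (e * x) / F x)"
      by (simp add: sum_divide_distrib add_divide_distrib)
    also have "\<dots> < S + d + d"
    proof (rule add_strict_mono)
      have "F (e * x) / F x \<le> 2 * e powr (-\<alpha>)" using elim pos[of x] by (simp add: divide_le_eq)
      then have "D * \<mu> powr (\<alpha> / 2 * real K) * (F (e * x) / F x) \<le> D * \<mu> powr (\<alpha> / 2 * real K) * (2 * e powr (-\<alpha>))"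
        using D(1) by (intro mult_left_mono) auto
      then show "D * \<mu> powr (\<alpha> / 2 * real K) * (F (e * x) / F x) < d" using K by linarith
    qed (use elim in simp)
    finally show ?case using d by simp
  qed
qed

theorem tail_ratio_limits:
  "((\<lambda>x. prob {\<omega> \<in> space M. ennreal x < progeny t \<omega>} / F x) \<longlongrightarrow> (\<Sum>k. \<mu> powr (real k * \<alpha>))) at_top"
  "((\<lambda>x. prob {\<omega> \<in> space M. ennreal x < largest t \<omega>} / F x) \<longlongrightarrow> (\<Sum>k. \<mu> powr (real k * \<alpha>))) at_top"
proof -
  have le: "prob {\<omega> \<in> space M. ennreal x < largest t \<omega>} / F x \<le> prob {\<omega> \<in> space M. ennreal x < progeny t \<omega>} / F x" for x
    using less_imp_le[OF pos] largest_le_progeny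
    by (intro divide_right_mono finite_measure_mono) (auto intro: less_le_trans)
  show "((\<lambda>x. prob {\<omega> \<in> space M. ennreal x < progeny t \<omega>} / F x) \<longlongrightarrow> (\<Sum>k. \<mu> powr (real k * \<alpha>))) at_top"
  proof (rule order_tendstoI)
    fix l assume "l < (\<Sum>k. \<mu> powr (real k * \<alpha>))"
    from eventually_largest_gt[OF this, of t]
    show "\<forall>\<^sub>F x in at_top. l < prob {\<omega> \<in> space M. ennreal x < progeny t \<omega>} / F x"
      by eventually_elim (rule less_le_trans[OF _ le])
  qed (rule eventually_progeny_less)
  show "((\<lambda>x. prob {\<omega> \<in> space M. ennreal x < largest t \<omega>} / F x) \<longlongrightarrow> (\<Sum>k. \<mu> powr (real k * \<alpha>))) at_top"
  proof (rule order_tendstoI)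
    fix l assume "(\<Sum>k. \<mu> powr (real k * \<alpha>)) < l"
    from eventually_progeny_less[OF this, of t]
    show "\<forall>\<^sub>F x in at_top. prob {\<omega> \<in> space M. ennreal x < largest t \<omega>} / F x < l"
      by eventually_elim (rule le_less_trans[OF le])
  qed (rule eventually_largest_gt)
qed

end

text \<open>Positivity is given only for large arguments, but a decreasing function that is positive there is positive
  everywhere.\<close>

lemma rv_tail_of_slowly_varying:
  assumes alpha: "0 < \<alpha>" and L: "slowly_varying L"
    and F: "\<And>x. x > 0 \<Longrightarrow> F x = x powr (-\<alpha>) * L x"
    and anti: "\<And>x y. x \<le> y \<Longrightarrow> F y \<le> F x"
  shows "rv_tail F \<alpha>"
proof
  obtain c where c: "c > 0" "\<And>x. x \<ge> c \<Longrightarrow> L x > 0"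
    using L unfolding slowly_varying_def by auto
  show "F x > 0" for x
  proof -
    have "0 < F (max x c)" using c by (subst F) (auto simp: less_max_iff_disj)
    also have "\<dots> \<le> F x" by (rule anti) simp
    finally show ?thesis .
  qed
  show "((\<lambda>x. F (d * x) / F x) \<longlongrightarrow> d powr (-\<alpha>)) at_top" if d: "d > 0" for d
  proof -
    have "((\<lambda>x. d powr (-\<alpha>) * (L (d * x) / L x)) \<longlongrightarrow> d powr (-\<alpha>) * 1) at_top"
      using L d unfolding slowly_varying_def by (intro tendsto_intros) auto
    moreover have "\<forall>\<^sub>F x in at_top. d powr (-\<alpha>) * (L (d * x) / L x) = F (d * x) / F x"
      using eventually_gt_at_top[of 0]
      by eventually_elim (use d in \<open>simp add: F powr_mult\<close>)
    ultimately show ?thesis by (simp add: filterlim_cong)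
  qed
qed (use alpha anti in auto)

lemma prob_eq_of_distr_eq:
  assumes "X \<in> borel_measurable N" "Z \<in> borel_measurable M" "distr N borel X = distr M borel Z"
  shows "measure N {\<omega> \<in> space N. X \<omega> > (y :: ennreal)} = measure M {\<omega> \<in> space M. Z \<omega> > y}"
proof -
  have "measure N {\<omega> \<in> space N. X \<omega> > y} = measure (distr N borel X) {y<..}"
    using assms(1) by (subst measure_distr) (auto intro: arg_cong[where f = "measure N"])
  also have "\<dots> = measure M {\<omega> \<in> space M. Z \<omega> > y}"
    unfolding assms(3) using assms(2)
    by (subst measure_distr) (auto intro: arg_cong[where f = "measure M"])
  finally show ?thesis .
qed

theorem theorem2p2:
  fixes P :: "'p measure" and A B :: "'p \<Rightarrow> nat"
    and M :: "'m measure"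
    and a :: "int \<Rightarrow> int \<Rightarrow> nat \<Rightarrow> 'm \<Rightarrow> nat" and b :: "int \<Rightarrow> 'm \<Rightarrow> nat"
    and N :: "'n measure" and X :: "'n \<Rightarrow> ennreal"
    and N' :: "'o measure" and X' :: "'o \<Rightarrow> ennreal"
    and L :: "real \<Rightarrow> real" and \<alpha> \<mu> :: real and t :: int
  assumes P: "prob_space P"
    and A: "A \<in> measurable P (count_space UNIV)"
    and B: "B \<in> measurable P (count_space UNIV)"
    and A_int: "integrable P (\<lambda>\<omega>. real (A \<omega>))"
    and mu: "\<mu> = prob_space.expectation P (\<lambda>\<omega>. real (A \<omega>))" "0 < \<mu>" "\<mu> < 1"
    and ln_B: "(\<integral>\<^sup>+\<omega>. ennreal (ln (1 + real (B \<omega>))) \<partial>P) < \<infinity>"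
    and alpha: "0 < \<alpha>" "\<alpha> < 2"
    and L: "slowly_varying L"
    and tail_B: "\<And>x. x > 0 \<Longrightarrow> \<P>(\<omega> in P. real (B \<omega>) > x) = x powr (-\<alpha>) * L x"
    and A_sq: "\<alpha> \<ge> 1 \<Longrightarrow> (\<integral>\<^sup>+\<omega>. ennreal ((real (A \<omega>))\<^sup>2) \<partial>P) < \<infinity>"
    and tail_A:
      "(\<integral>\<^sup>+\<omega>. ennreal (real (B \<omega>)) \<partial>P) < \<infinity> \<and>
         (\<lambda>x::real. \<P>(\<omega> in P. real (A \<omega>) > x)) \<in> o[at_top](\<lambda>x. \<P>(\<omega> in P. real (B \<omega>) > x))
       \<or> (\<integral>\<^sup>+\<omega>. ennreal (real (B \<omega>)) \<partial>P) = \<infinity> \<and>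
         (\<lambda>x::real. x * \<P>(\<omega> in P. real (A \<omega>) > x)) \<in> o[at_top](\<lambda>x. \<P>(\<omega> in P. real (B \<omega>) > x))"
    and M: "prob_space M"
    and indep: "prob_space.indep_vars M (\<lambda>_. count_space UNIV)
                  (case_sum b (\<lambda>(s, u, i). a s u i)) (UNIV :: (int + int \<times> int \<times> nat) set)"
    and a_copy: "\<And>s u i. distr M (count_space UNIV) (a s u i) = distr P (count_space UNIV) A"
    and b_copy: "\<And>s. distr M (count_space UNIV) (b s) = distr P (count_space UNIV) B"
    and N: "prob_space N" and X: "X \<in> borel_measurable N"
    and X_law: "distr N borel X = distr M borel (\<lambda>\<omega>. \<Sum>k. of_nat (C a b t k \<omega>))"
    and N': "prob_space N'" and X': "X' \<in> borel_measurable N'"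
    and X'_law: "distr N' borel X' = distr M borel (\<lambda>\<omega>. SUP k. of_nat (C a b t k \<omega>))"
  shows "((\<lambda>x::real. \<P>(\<omega> in N. X \<omega> > ennreal x) / \<P>(\<omega> in P. real (B \<omega>) > x))
            \<longlongrightarrow> (\<Sum>k. \<mu> powr (real k * \<alpha>))) at_top \<and>
         ((\<lambda>x::real. \<P>(\<omega> in N'. X' \<omega> > ennreal x) / \<P>(\<omega> in P. real (B \<omega>) > x))
            \<longlongrightarrow> (\<Sum>k. \<mu> powr (real k * \<alpha>))) at_top"
proof -
  interpret P: prob_space P by fact
  obtain p where p: "distr P (count_space UNIV) A = measure_pmf p"
    by (rule pmf_of_nat_distr[OF P A])
  obtain q where q: "distr P (count_space UNIV) B = measure_pmf q"
    by (rule pmf_of_nat_distr[OF P B])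
  define F where "F x = \<P>(\<omega> in P. real (B \<omega>) > x)" for x
  have nn_p: "(\<integral>\<^sup>+n. h n \<partial>p) = (\<integral>\<^sup>+\<omega>. h (A \<omega>) \<partial>P)" for h
    unfolding p[symmetric] using A by (simp add: nn_integral_distr)
  have mean: "(\<integral>\<^sup>+n. ennreal (real n) \<partial>p) = ennreal \<mu>"
    unfolding nn_p mu(1) using A_int by (intro nn_integral_eq_integral) auto
  have "rv_tail F \<alpha>"
  proof (rule rv_tail_of_slowly_varying[OF alpha(1) L])
    show "F x = x powr (-\<alpha>) * L x" if "x > 0" for x
      unfolding F_def by (rule tail_B[OF that])
    show "F y \<le> F x" if "x \<le> y" for x y
      unfolding F_def using B that by (intro P.finite_measure_mono) auto
  qed
  moreover have "gw_tail_axioms F \<alpha> p q \<mu>"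
  proof
    show "F x = measure_pmf.prob q {n. x < real n}" for x
      unfolding F_def q[symmetric] using B
      by (subst measure_distr) (auto intro: arg_cong[where f = "measure P"])
    show "\<exists>v\<ge>0. (\<integral>\<^sup>+n. ennreal ((real n)\<^sup>2) \<partial>p) = ennreal (v + \<mu>\<^sup>2)" if a1: "1 \<le> \<alpha>"
    proof -
      obtain m where m: "(\<integral>\<^sup>+n. ennreal ((real n)\<^sup>2) \<partial>p) = ennreal m" "0 \<le> m"
        using A_sq[OF a1] unfolding nn_p by (cases "\<integral>\<^sup>+\<omega>. ennreal ((real (A \<omega>))\<^sup>2) \<partial>P") auto
      have "\<mu>\<^sup>2 \<le> m"
        using mean_sq_le_second_moment[OF mean _ m] mu(2) by simp
      then show ?thesis using m by (intro exI[of _ "m - \<mu>\<^sup>2"]) simp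
    qed
  qed (use mean mu alpha in auto)
  moreover have "gw_immigration M a b p q"
    using M indep a_copy b_copy unfolding gw_immigration_def gw_immigration_axioms_def p q by blast
  ultimately interpret gw_immigration_tail M a b p q F \<alpha> \<mu>
    by (intro gw_immigration_tail.intro gw_tail.intro)
  have "measure N {\<omega> \<in> space N. ennreal x < X \<omega>} = prob {\<omega> \<in> space M. ennreal x < progeny t \<omega>}" for x
    using X_law by (intro prob_eq_of_distr_eq X measurable_progeny) (simp add: progeny_def[abs_def])
  moreover have "measure N' {\<omega> \<in> space N'. ennreal x < X' \<omega>} = prob {\<omega> \<in> space M. ennreal x < largest t \<omega>}" for x
    using X'_law by (intro prob_eq_of_distr_eq X' measurable_largest) (simp add: largest_def[abs_def])
  ultimately show ?thesis
    using tail_ratio_limits[of t] unfolding F_def by simp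
qed

end
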